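(* Let $(M,N)$ be an upper semi-Fredholm pair of closed subspaces of a $BFU$-space $X$. Let $(M_n)_{n\in\mathbb N'}$, $(N_n)_{n\in\mathbb N'}$ be two sequences of closed subspaces of $X$, and set $\lambda_M=\lambda_{\mathbb N'}[M,M_n]$, $\lambda_N=\lambda_{\mathbb N'}[N,N_n]$. Then: 1. Define $\omega=\psi(M,N)(\lambda_M+\lambda_N)$. If $\omega<1$, then for large enough $n\in\mathbb N'$ the pairs $(M_n,N_n)$ are also upper semi-Fredholm and $\varlimsup_{n\in\mathbb N'}\beta(M_n,N_n)<\infty$. 2. Suppose that $X=(M+N)\oplus S$ for a closed subspace $S$ and define $\omega_S(M)=\psi_S(M,N)(\lambda_M+\lambda_N)$. If $\omega_S(M)<1$, $\mathbb N''\subset\mathbb N'$ is infinite and $(W_n)_{n\in\mathbb N''}$ is a sequence of non-null closed subspaces of $X^*$ such that $W_n\subset M_n^\perp$ for all $n\in\mathbb N''$ and $\delta(W_n,N_n^\perp)\to0$, then there exists $K\in\mathbb N$ such that $\dim W_n\le K$ for large enough $n\in\mathbb N''$.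
   Context: $\mathbb N'$ denotes an infinite subset of $\mathbb N$. A topological (Hausdorff) space is Fréchet–Urysohn if every point of the closure of a subset $G$ is the limit of a sequence from $G$. A Banach space $X$ is a $BFU$-space if every norm bounded subset of $X^*$ is a Fréchet–Urysohn space in the topology induced by the weak$^*$ topology $\sigma(X^*,X)$. $M^\perp\subset X^*$ is the annihilator of $M$. Gap: $\delta(W,P)=\sup\{dist(x,P):x\in W,\|x\|=1\}$. A pair $(M,N)$ of closed subspaces of $X$ is upper semi-Fredholm if $\beta(M,N):=\dim X/(M+N)<\infty$ (then $M+N$ is closed). If $X=(M+N)\oplus S$ with $M+N$ and $S$ closed, $\psi_S(M,N)$ is the infimum of numbers $\gamma>0$ such that every $x\in X$ can be written $x=a+b+c$ with $a\in M$, $b\in N$, $c\in S$ and $\max\{\|a\|,\|b\|,\|c\|\}\le\gamma\|x\|$. $\psi(M,N)=\inf\{\psi_S(M,N): S\text{ closed},\ X=(M+N)\oplus S\}$. Uniform $\lambda$-adjustment: a sequence $(M_n)_{\mathbb N'}$ of nonzero closed subspaces of $X$ is lower uniformly $\lambda$-adjusted ($\lambda\ge0$) with a sequence $(P_n)_{\mathbb N'}$ of closed subspaces if for every $\eta>0$, every infinite $\mathbb N''\subset\mathbb N'$ and every sequence of unit vectors $x_n\in M_n$ ($n\in\mathbb N''$) there exist an infinite $\mathbb N'''\subset\mathbb N''$, $y_n\in P_n$ ($n\in\mathbb N'''$) and $z\in X$ with $\varlimsup_{n\in\mathbb N'''}\|x_n-y_n-z\|\le\lambda+\eta$; $\lambda_{\mathbb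 N'}[M_n,P_n]$ is the infimum of such $\lambda$. A single subspace is regarded as a constant sequence; subspaces in the first slot are understood to be nonzero. *)

theory Defs
  imports "HOL-Analysis.Analysis"
begin

text \<open>
  A Banach space over the real or the complex numbers. The sort
  \<open>{real_normed_field, euclidean_space}\<close> contains \<open>real\<close> and \<open>complex\<close> and, up to isomorphism,
  nothing else. The scalar multiplication \<open>smul\<close> extends the multiplication by real scalars that
  belongs to the class \<open>banach\<close>; if the scalar field is \<open>real\<close>, it coincides with it.
\<close>

locale banach_over = vector_space smul
  for smul :: "'k::{real_normed_field, euclidean_space} \<Rightarrow> 'a::banach \<Rightarrow> 'a" +
  assumes norm_scale: "norm (smul c x) = norm c * norm x"
    and scale_of_real: "smul (of_real r) x = r *\<^sub>R x"

lemma banach_over_scaleR: "banach_over (scaleR :: real \<Rightarrow> 'a::banach \<Rightarrow> 'a)"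
  by unfold_locales (simp_all add: algebra_simps)

definition closed_subspace ::
    "('k::field \<Rightarrow> 'v::{ab_group_add, topological_space} \<Rightarrow> 'v) \<Rightarrow> 'v set \<Rightarrow> bool" where
  "closed_subspace smul M \<longleftrightarrow> module.subspace smul M \<and> closed M"

text \<open>
  The dimension of a subspace, infinite if there is no finite spanning set
  (\<^const>\<open>vector_space.dim\<close> is then \<open>0\<close>).
\<close>

definition edim :: "('k::field \<Rightarrow> 'v::ab_group_add \<Rightarrow> 'v) \<Rightarrow> 'v set \<Rightarrow> enat" where
  "edim smul W =
    (if \<exists>B. finite B \<and> W \<subseteq> module.span smul B then enat (vector_space.dim smul W) else \<infinity>)"

text \<open>
  The dimension of the algebraic quotient of the whole space by the subspace \<open>L\<close>: the least
  number of cosets \<open>b + L\<close> that span the quotient (\<open>\<infinity>\<close> if no finite number does).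
\<close>

definition codim :: "('k::field \<Rightarrow> 'v::ab_group_add \<Rightarrow> 'v) \<Rightarrow> 'v set \<Rightarrow> enat" where
  "codim smul L = (INF B \<in> {B. finite B \<and> module.span smul (B \<union> L) = UNIV}. enat (card B))"

definition defect :: "('k::field \<Rightarrow> 'v::ab_group_add \<Rightarrow> 'v) \<Rightarrow> 'v set \<Rightarrow> 'v set \<Rightarrow> enat" where
  "defect smul M N = codim smul (M + N)"

definition upper_semi_Fredholm ::
    "('k::field \<Rightarrow> 'v::{ab_group_add, topological_space} \<Rightarrow> 'v) \<Rightarrow> 'v set \<Rightarrow> 'v set \<Rightarrow> bool" where
  "upper_semi_Fredholm smul M N \<longleftrightarrow>
    closed_subspace smul M \<and> closed_subspace smul N \<and> defect smul M N < \<infinity>"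

text \<open>The whole space is the direct sum of \<open>L\<close> and the closed subspace \<open>S\<close>.\<close>

definition closed_complement ::
    "('k::field \<Rightarrow> 'v::{ab_group_add, topological_space} \<Rightarrow> 'v) \<Rightarrow> 'v set \<Rightarrow> 'v set \<Rightarrow> bool" where
  "closed_complement smul L S \<longleftrightarrow> closed_subspace smul S \<and> L + S = UNIV \<and> L \<inter> S = {0}"

definition psi_compl :: "'a::real_normed_vector set \<Rightarrow> 'a set \<Rightarrow> 'a set \<Rightarrow> real" where
  "psi_compl S M N =
    Inf {\<gamma>. \<gamma> > 0 \<and>
          (\<forall>x. \<exists>a\<in>M. \<exists>b\<in>N. \<exists>c\<in>S. x = a + b + c \<and>
                 max (norm a) (max (norm b) (norm c)) \<le> \<gamma> * norm x)}"

definition psi ::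
    "('k::field \<Rightarrow> 'a::real_normed_vector \<Rightarrow> 'a) \<Rightarrow> 'a set \<Rightarrow> 'a set \<Rightarrow> real" where
  "psi smul M N = Inf {psi_compl S M N | S. closed_complement smul (M + N) S}"

text \<open>
  A sequence indexed by an infinite set \<open>A\<close> of natural numbers is a function on \<open>nat\<close> of which only
  the values on \<open>A\<close> matter; \<open>along A\<close> is the filter of limits over \<open>n \<in> A\<close>, \<open>n \<longrightarrow> \<infinity>\<close>.
\<close>

abbreviation along :: "nat set \<Rightarrow> nat filter" where
  "along A \<equiv> inf sequentially (principal A)"

definition unif_adjusted ::
    "nat set \<Rightarrow> (nat \<Rightarrow> 'a::real_normed_vector set) \<Rightarrow> (nat \<Rightarrow> 'a set) \<Rightarrow> real \<Rightarrow> bool" where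
  "unif_adjusted A M P l \<longleftrightarrow>
    (\<forall>\<eta>>0. \<forall>A2 x. A2 \<subseteq> A \<and> infinite A2 \<and> (\<forall>n\<in>A2. x n \<in> M n \<and> norm (x n) = 1) \<longrightarrow>
      (\<exists>A3 y z. A3 \<subseteq> A2 \<and> infinite A3 \<and> (\<forall>n\<in>A3. y n \<in> P n) \<and>
         Limsup (along A3) (\<lambda>n. ereal (norm (x n - y n - z))) \<le> ereal (l + \<eta>)))"

definition adj_lambda ::
    "nat set \<Rightarrow> (nat \<Rightarrow> 'a::real_normed_vector set) \<Rightarrow> (nat \<Rightarrow> 'a set) \<Rightarrow> real" where
  "adj_lambda A M P = Inf {l. l \<ge> 0 \<and> unif_adjusted A M P l}"

text \<open>
  The dual space with respect to the given scalar field, inside the space of real-linear bounded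
  maps into that field, from which it inherits the dual norm.
\<close>

definition dual ::
    "('k::{real_normed_field, euclidean_space} \<Rightarrow> 'a::real_normed_vector \<Rightarrow> 'a) \<Rightarrow> ('a \<Rightarrow>\<^sub>L 'k) set" where
  "dual smul = {f. \<forall>c x. blinfun_apply f (smul c x) = c * blinfun_apply f x}"

definition dual_scale ::
    "'k::{real_normed_field, euclidean_space} \<Rightarrow> ('a::real_normed_vector \<Rightarrow>\<^sub>L 'k) \<Rightarrow> ('a \<Rightarrow>\<^sub>L 'k)" where
  "dual_scale c f = blinfun_mult_right c o\<^sub>L f"

lemma dual_scale_apply: "blinfun_apply (dual_scale c f) x = c * blinfun_apply f x"
  by (simp add: dual_scale_def)

lemma vector_space_dual_scale: "vector_space dual_scale"
  by unfold_locales
    (rule blinfun_eqI; simp add: dual_scale_apply plus_blinfun.rep_eq algebra_simps)+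

definition weak_star_topology ::
    "('k::{real_normed_field, euclidean_space} \<Rightarrow> 'a::real_normed_vector \<Rightarrow> 'a) \<Rightarrow> ('a \<Rightarrow>\<^sub>L 'k) topology" where
  "weak_star_topology smul = subtopology strong_operator_topology (dual smul)"

definition annihilator ::
    "('k::{real_normed_field, euclidean_space} \<Rightarrow> 'a::real_normed_vector \<Rightarrow> 'a) \<Rightarrow> 'a set \<Rightarrow> ('a \<Rightarrow>\<^sub>L 'k) set" where
  "annihilator smul M = {f \<in> dual smul. \<forall>x\<in>M. blinfun_apply f x = 0}"

definition Frechet_Urysohn_space :: "'b topology \<Rightarrow> bool" where
  "Frechet_Urysohn_space T \<longleftrightarrow> Hausdorff_space T \<and>
    (\<forall>G \<subseteq> topspace T. \<forall>p \<in> T closure_of G. \<exists>s. range s \<subseteq> G \<and> limitin T s p sequentially)"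

definition BFU_space ::
    "('k::{real_normed_field, euclidean_space} \<Rightarrow> 'a::real_normed_vector \<Rightarrow> 'a) \<Rightarrow> bool" where
  "BFU_space smul \<longleftrightarrow>
    (\<forall>B. B \<subseteq> dual smul \<and> bounded B \<longrightarrow>
       Frechet_Urysohn_space (subtopology (weak_star_topology smul) B))"

definition gap :: "'v::real_normed_vector set \<Rightarrow> 'v set \<Rightarrow> real" where
  "gap W P = (SUP x \<in> {x \<in> W. norm x = 1}. infdist x P)"

end

theory Submission
  imports Defs
begin

text \<open>
  Suppose that \<open>W n\<close> annihilates \<open>Mn n\<close>, is asymptotically small on \<open>Nn n\<close>, and has unbounded
  dimension. The \<open>BFU\<close> property then gives unit functionals \<open>f n \<in> W n\<close> that converge weak-star to
  zero along an infinite set of indices. Evaluate \<open>f n\<close> at a unit vector \<open>x n = a + b + c\<close> on which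
  it almost attains its norm, with \<open>a \<in> M\<close>, \<open>b \<in> N\<close>, \<open>c \<in> S\<close> of norm at most \<open>\<gamma>\<close>. By the adjustment
  hypothesis \<open>a\<close> and \<open>b\<close> are, up to \<open>\<gamma> * lM\<close> and \<open>\<gamma> * lN\<close>, the sum of a vector on which \<open>f n\<close> almost
  vanishes and of a multiple of a fixed vector, and \<open>c\<close> subconverges since \<open>S\<close> has finite dimension.
  Hence \<open>1 \<le> \<gamma> * (lM + lN)\<close> in the limit, a contradiction. This is the second claim.

  For the first claim, if \<open>Mn n + Nn n\<close> has codimension at least \<open>k\<close> (it need not be closed), then
  some \<open>k\<close>-dimensional space of functionals annihilates \<open>Mn n\<close> and is as small on \<open>Nn n\<close> as desired,
  so the same argument applies. Smallness on \<open>Nn n\<close> replaces the gap condition throughout.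
\<close>

section \<open>Closed subspaces\<close>

context banach_over
begin

section \<open>Finite-dimensional extensions of closed subspaces\<close>

lemma scaleR_in_subspace: "subspace L \<Longrightarrow> x \<in> L \<Longrightarrow> r *\<^sub>R x \<in> L"
  using subspace_scale[of L x "of_real r"] by (simp add: scale_of_real)

lemma tendsto_smul:
  assumes "(c \<longlongrightarrow> c0) F"
  shows "((\<lambda>n. smul (c n) b) \<longlongrightarrow> smul c0 b) F"
proof -
  have "((\<lambda>n. norm (c n - c0) * norm b) \<longlongrightarrow> norm (c0 - c0) * norm b) F"
    by (intro tendsto_intros assms)
  then have "((\<lambda>n. norm (smul (c n) b - smul c0 b)) \<longlongrightarrow> 0) F"
    by (simp add: norm_scale flip: scale_left_diff_distrib)
  then show ?thesis
    using Lim_null tendsto_norm_zero_iff by blast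
qed

text \<open>Factoring out \<open>c\<close> leaves \<open>b\<close> minus a vector of
  \<open>L\<close>, whose norm is at least the distance from \<open>b\<close> to \<open>L\<close>.
  The bound lets the coefficient of \<open>b\<close> be controlled by the norm of the whole
  vector.\<close>

lemma norm_scale_add_ge:
  assumes L: "subspace L" "closed L" and b: "b \<notin> L"
  obtains d where "d > 0" "\<And>c y. y \<in> L \<Longrightarrow> d * norm c \<le> norm (smul c b + y)"
proof
  show "infdist b L > 0"
    using L b subspace_0 by (intro infdist_pos_not_in_closed) auto
  show "infdist b L * norm c \<le> norm (smul c b + y)" if y: "y \<in> L" for c y
  proof (cases "c = 0")
    case False
    have "smul (- inverse c) y \<in> L"
      using L(1) y by (rule subspace_scale)
    then have "infdist b L \<le> norm (b - smul (- inverse c) y)"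
      by (metis dist_norm infdist_le)
    moreover have "smul c b + y = smul c (b - smul (- inverse c) y)"
      using False by (simp add: scale_right_distrib)
    ultimately show ?thesis
      by (simp add: norm_scale mult.commute mult_left_mono)
  qed simp
qed

text \<open>Along a convergent sequence the coefficients of \<open>b\<close> are Cauchy by
  \<open>norm_scale_add_ge\<close>, hence converge in the scalar field; the remaining parts then
  converge within \<open>L\<close>.\<close>

lemma closed_span_insert:
  assumes L: "subspace L" "closed L"
  shows "closed (span (insert b L))"
proof (cases "b \<in> L")
  case True
  then show ?thesis
    using L by (simp add: insert_absorb span_eq_iff[THEN iffD2])
next
  case False
  then obtain d where d: "d > 0" "\<And>c y. y \<in> L \<Longrightarrow> d * norm c \<le> norm (smul c b + y)"
    using norm_scale_add_ge L by metis
  show ?thesis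
    unfolding closed_sequential_limits
  proof (intro allI impI, elim conjE)
    fix x l assume x: "\<forall>n. x n \<in> span (insert b L)" and lim: "x \<longlonglongrightarrow> l"
    have "\<exists>c. x n - smul c b \<in> L" for n
      using x L by (metis span_breakdown_eq span_eq_iff)
    then obtain c where c: "\<And>n. x n - smul (c n) b \<in> L"
      by metis
    have key: "norm (c m - c n) \<le> norm (x m - x n) / d" for m n
    proof -
      have "(x m - smul (c m) b) - (x n - smul (c n) b) \<in> L"
        using c L(1) subspace_diff by blast
      then have "d * norm (c m - c n) \<le>
          norm (smul (c m - c n) b + ((x m - smul (c m) b) - (x n - smul (c n) b)))"
        by (rule d(2))
      then show ?thesis
        using d(1) by (simp add: scale_left_diff_distrib field_simps)
    qed
    have "Cauchy c"
    proof (rule metric_CauchyI)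
      fix e :: real assume "e > 0"
      then obtain K where K: "\<And>m n. m \<ge> K \<Longrightarrow> n \<ge> K \<Longrightarrow> dist (x m) (x n) < e * d"
        using metric_CauchyD[OF LIMSEQ_imp_Cauchy[OF lim], of "e * d"] d(1) by auto
      have "dist (c m) (c n) < e" if "m \<ge> K" "n \<ge> K" for m n
      proof -
        have "norm (x m - x n) / d < e"
          using K[OF that] d(1) by (simp add: dist_norm pos_divide_less_eq)
        then show ?thesis
          using key[of m n] by (simp add: dist_norm)
      qed
      then show "\<exists>K. \<forall>m\<ge>K. \<forall>n\<ge>K. dist (c m) (c n) < e"
        by blast
    qed
    then obtain c0 where "c \<longlonglongrightarrow> c0"
      using Cauchy_convergent convergent_def by blast
    then have "(\<lambda>n. x n - smul (c n) b) \<longlonglongrightarrow> l - smul c0 b"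
      by (intro tendsto_diff lim tendsto_smul)
    with L(2) c have "l - smul c0 b \<in> L"
      by (rule closed_sequentially)
    then show "l \<in> span (insert b L)"
      using L(1) by (metis span_breakdown_eq span_eq_iff)
  qed
qed

lemma closed_span_Un:
  assumes "subspace L" "closed L" "finite B"
  shows "closed (span (B \<union> L))"
  using assms(3)
proof induction
  case empty
  then show ?case
    using assms by (simp add: span_eq_iff[THEN iffD2])
next
  case (insert b B)
  have "span (insert b B \<union> L) = span (insert b (span (B \<union> L)))"
    by (simp add: span_insert span_span)
  then show ?case
    using closed_span_insert[of "span (B \<union> L)" b] insert by simp
qed

lemma closed_span_finite: "finite B \<Longrightarrow> closed (span B)"
  using closed_span_Un[of "{0}" B] by (simp add: subspace_single_0)

text \<open>Bolzano--Weierstrass by induction on the generators: the coefficient of the new one is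
  bounded because the old span is closed, so a subsequence of coefficients converges and the rest
  falls to the induction hypothesis.\<close>

lemma span_finite_seq_compact:
  assumes "finite B" "\<And>n. x n \<in> span B" "bounded (range x)"
  shows "\<exists>l r. strict_mono (r :: nat \<Rightarrow> nat) \<and> (x \<circ> r) \<longlonglongrightarrow> l"
  using assms
proof (induction B arbitrary: x)
  case empty
  then have "x = (\<lambda>_. 0)"
    by (auto simp: fun_eq_iff)
  then show ?case
    by (auto intro!: exI[of _ 0] exI[of _ id] simp: strict_mono_def o_def)
next
  case (insert b B)
  show ?case
  proof (cases "b \<in> span B")
    case True
    then show ?thesis
      using insert by (simp add: span_redundant)
  next
    case False
    then obtain d where d: "d > 0" "\<And>c y. y \<in> span B \<Longrightarrow> d * norm c \<le> norm (smul c b + y)"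
      using norm_scale_add_ge[of "span B" b] closed_span_finite insert by auto
    have "\<exists>c. x n - smul c b \<in> span B" for n
      using insert.prems(1) by (simp flip: span_breakdown_eq)
    then obtain c where c: "\<And>n. x n - smul (c n) b \<in> span B"
      by metis
    obtain R where R: "\<And>n. norm (x n) \<le> R"
      using insert.prems(2) by (auto simp: bounded_iff)
    have cR: "norm (c n) \<le> R / d" for n
      using d(2)[OF c, of "c n" n] R[of n] d(1) by (simp add: field_simps)
    then have "bounded (range c)"
      by (auto simp: bounded_iff)
    then obtain c0 r where r: "strict_mono (r :: nat \<Rightarrow> nat)" "(c \<circ> r) \<longlonglongrightarrow> c0"
      using bounded_imp_convergent_subsequence by blast
    define y where "y n = x (r n) - smul (c (r n)) b" for n
    have "norm (y n) \<le> R + R / d * norm b" for n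
      unfolding y_def
      unfolding norm_scale[symmetric] using mult_right_mono[OF cR[of "r n"], of "norm b"] R[of "r n"]
      by (intro norm_triangle_le_diff) (simp add: norm_scale)
    then have "bounded (range y)"
      by (auto simp: bounded_iff)
    moreover have "y n \<in> span B" for n
      using c by (simp add: y_def)
    ultimately obtain l q where q: "strict_mono (q :: nat \<Rightarrow> nat)" "(y \<circ> q) \<longlonglongrightarrow> l"
      using insert.IH by blast
    have "(\<lambda>n. y (q n) + smul (c (r (q n))) b) \<longlonglongrightarrow> l + smul c0 b"
      using q LIMSEQ_subseq_LIMSEQ[OF r(2) q(1)]
      by (intro tendsto_add tendsto_smul) (simp_all add: o_def)
    then have "(x \<circ> (r \<circ> q)) \<longlonglongrightarrow> l + smul c0 b"
      by (simp add: y_def o_def)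
    then show ?thesis
      using strict_mono_o[OF r(1) q(1)] by blast
  qed
qed

section \<open>Successive approximation and the open mapping argument\<close>

lemma closed_subspace_suminf:
  fixes q :: real
  assumes "closed_subspace smul L" and f: "\<And>n. f n \<in> L" and le: "\<And>n. norm (f n) \<le> D * q ^ n"
    and q: "0 \<le> q" "q < 1"
  shows "suminf f \<in> L" "norm (suminf f) \<le> D / (1 - q)" "f sums suminf f"
proof -
  have geo: "(\<lambda>n. D * q ^ n) sums (D / (1 - q))"
    using sums_mult[OF geometric_sums[of q], of D] q by simp
  then have s: "summable (\<lambda>n. D * q ^ n)"
    by (rule sums_summable)
  then have sf: "summable f"
    using summable_comparison_test' le by blast
  then show sums: "f sums suminf f"
    by (rule summable_sums)
  have "(\<Sum>i<n. f i) \<in> L" for n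
    using assms by (intro subspace_sum) (auto simp: closed_subspace_def)
  moreover have "closed L"
    using assms(1) by (simp add: closed_subspace_def)
  ultimately show "suminf f \<in> L"
    using sums unfolding sums_def by (metis closed_sequentially)
  have "norm (suminf f) \<le> (\<Sum>n. D * q ^ n)"
    by (rule norm_suminf_le[OF le s])
  then show "norm (suminf f) \<le> D / (1 - q)"
    by (simp only: sums_unique[OF geo])
qed

text \<open>The approximate decomposition is applied again to each remainder. Remainders decay like
  \<open>q ^ n\<close>, so the corrections form absolutely convergent series, and the geometric sum
  yields the factor \<open>1 / (1 - q)\<close>.\<close>

lemma successive_approximation:
  assumes cl: "closed_subspace smul M" "closed_subspace smul N" "closed_subspace smul S"
    and q: "0 \<le> q" "q < 1"
    and ex: "\<And>x. \<exists>a\<in>M. \<exists>b\<in>N. \<exists>c\<in>S. norm a \<le> C * norm x \<and> norm b \<le> C * norm x \<and>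
        norm c \<le> C * norm x \<and> norm (x - a - b - c) \<le> q * norm x"
  shows "\<exists>a\<in>M. \<exists>b\<in>N. \<exists>c\<in>S. x = a + b + c \<and>
     max (norm a) (max (norm b) (norm c)) \<le> C / (1 - q) * norm x"
proof -
  obtain A B D where *: "\<And>x. A x \<in> M" "\<And>x. B x \<in> N" "\<And>x. D x \<in> S"
    "\<And>x. norm (A x) \<le> C * norm x" "\<And>x. norm (B x) \<le> C * norm x" "\<And>x. norm (D x) \<le> C * norm x"
    "\<And>x. norm (x - A x - B x - D x) \<le> q * norm x"
    using ex by metis
  define r where "r n = ((\<lambda>x. x - A x - B x - D x) ^^ n) x" for n
  have r0: "r 0 = x" and rS: "r (Suc n) = r n - A (r n) - B (r n) - D (r n)" for n
    by (simp_all add: r_def)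
  have rn: "norm (r n) \<le> norm x * q ^ n" for n
  proof (induction n)
    case (Suc n)
    have "norm (r (Suc n)) \<le> q * norm (r n)"
      using * rS by metis
    also have "\<dots> \<le> q * (norm x * q ^ n)"
      using Suc q by (intro mult_left_mono) auto
    finally show ?case
      by (simp add: mult_ac)
  qed (simp add: r0)
  \<comment> \<open>On the zero space \<open>ex\<close> says nothing about the sign of
    \<open>C\<close>.\<close>
  have C: "C \<ge> 0" if "x \<noteq> 0"
    using *(4)[of x] that by (smt (verit) norm_ge_zero zero_le_mult_iff zero_less_norm_iff)
  have le: "C * norm (r n) \<le> C * norm x * q ^ n" for n
  proof (cases "x = 0")
    case True
    then show ?thesis
      using rn[of n] by simp
  next
    case False
    then show ?thesis
      using mult_left_mono[OF rn[of n] C] by (simp add: mult_ac)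
  qed
  note bd = order_trans[OF *(4) le] order_trans[OF *(5) le] order_trans[OF *(6) le]
  define a b c where abc: "a = suminf (\<lambda>n. A (r n))" "b = suminf (\<lambda>n. B (r n))"
    "c = suminf (\<lambda>n. D (r n))"
  note a = closed_subspace_suminf[OF cl(1) *(1) bd(1) q, folded abc]
    and b = closed_subspace_suminf[OF cl(2) *(2) bd(2) q, folded abc]
    and c = closed_subspace_suminf[OF cl(3) *(3) bd(3) q, folded abc]
  have "(\<Sum>i<n. A (r i) + B (r i) + D (r i)) = x - r n" for n
    by (induction n) (simp_all add: r0 rS)
  moreover have "r \<longlonglongrightarrow> 0"
  proof (rule Lim_null_comparison)
    show "\<forall>\<^sub>F n in sequentially. norm (r n) \<le> norm x * q ^ n"
      using rn by simp
    show "(\<lambda>n. norm x * q ^ n) \<longlonglongrightarrow> 0"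
      using tendsto_mult_right_zero[OF LIMSEQ_realpow_zero[OF q]] by simp
  qed
  then have "(\<lambda>n. x - r n) \<longlonglongrightarrow> x"
    using tendsto_diff[OF tendsto_const, of r 0 sequentially x] by simp
  ultimately have "(\<lambda>n. A (r n) + B (r n) + D (r n)) sums x"
    by (simp add: sums_def)
  then have "x = a + b + c"
    using sums_add[OF sums_add[OF a(3) b(3)] c(3)] sums_unique2 by blast
  moreover have "max (norm a) (max (norm b) (norm c)) \<le> C / (1 - q) * norm x"
    using a(2) b(2) c(2) by (simp add: mult_ac)
  ultimately show ?thesis
    using a(1) b(1) c(1) by blast
qed

text \<open>This is the open mapping theorem for addition on \<open>M \<times> N \<times> S\<close>:
  Baire's theorem gives approximate decompositions with a uniform bound, and successive
  approximation makes them exact. It shows that the infimum in \<open>psi_compl\<close> is over a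
  nonempty set.\<close>

lemma bounded_decomposition:
  assumes cl: "closed_subspace smul M" "closed_subspace smul N" "closed_subspace smul S"
    and sum: "M + N + S = UNIV"
  shows "\<exists>\<gamma>>0. \<forall>x. \<exists>a\<in>M. \<exists>b\<in>N. \<exists>c\<in>S. x = a + b + c \<and>
     max (norm a) (max (norm b) (norm c)) \<le> \<gamma> * norm x"
proof -
  define T where "T n = {a + b + c |a b c. a \<in> M \<and> b \<in> N \<and> c \<in> S \<and>
      norm a \<le> real n \<and> norm b \<le> real n \<and> norm c \<le> real n}" for n
  have sub: "subspace M" "subspace N" "subspace S"
    using cl by (auto simp: closed_subspace_def)
  have "\<exists>n. x \<in> T n" for x
  proof -
    obtain a b c where abc: "x = a + b + c" "a \<in> M" "b \<in> N" "c \<in> S"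
      using sum by (metis UNIV_I set_plus_elim)
    obtain n where "max (norm a) (max (norm b) (norm c)) \<le> real n"
      using real_arch_simple by blast
    then show ?thesis
      using abc by (auto simp: T_def)
  qed
  then have U: "(\<Union>n. closure (T n)) = UNIV"
    using closure_subset by blast
  have "\<exists>n. interior (closure (T n)) \<noteq> {}"
  proof (rule ccontr)
    assume "\<not> ?thesis"
    then have "euclidean interior_of \<Union>(range (\<lambda>n. closure (T n))) = {}"
      by (intro Baire_category_alt) (auto simp: completely_metrizable_space_euclidean)
    then show False
      using U by simp
  qed
  then obtain n y where "y \<in> interior (closure (T n))"
    by blast
  then obtain r where r: "r > 0" "ball y r \<subseteq> closure (T n)"
    using mem_interior by blast
  \<comment> \<open>Differences of components of two points of \<open>T n\<close> have norm at most
    \<open>2 * real n\<close>; rescaling by \<open>k = 2 * norm x / r\<close> gives this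
    constant.\<close>
  define C where "C = 4 * real n / r"
  have "\<exists>a\<in>M. \<exists>b\<in>N. \<exists>c\<in>S. norm a \<le> C * norm x \<and> norm b \<le> C * norm x \<and>
        norm c \<le> C * norm x \<and> norm (x - a - b - c) \<le> 1 / 2 * norm x" for x
  proof (cases "x = 0")
    case True
    then show ?thesis
      using sub subspace_0 by fastforce
  next
    case False
    \<comment> \<open>Division by \<open>k\<close> brings \<open>x\<close> to norm
      \<open>r / 2\<close>, so \<open>y + x /\<^sub>R k\<close> stays in the ball. The two errors of
      \<open>r / 8\<close> below add up to \<open>r / 4\<close>, which becomes
      \<open>norm x / 2\<close> after scaling back.\<close>
    define k where "k = 2 * norm x / r"
    have k: "k > 0"
      using False r by (simp add: k_def)
    have "norm (x /\<^sub>R k) < r"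
      using False r by (simp add: k_def field_simps)
    then have "y + x /\<^sub>R k \<in> closure (T n)" "y \<in> closure (T n)"
      using r by (auto simp: dist_norm subset_iff)
    then obtain s t where s: "s \<in> T n" "dist s (y + x /\<^sub>R k) < r / 8"
      and t: "t \<in> T n" "dist t y < r / 8"
      using r(1) by (metis closure_approachable zero_less_divide_iff zero_less_numeral)
    obtain a b c where abc: "s = a + b + c" "a \<in> M" "b \<in> N" "c \<in> S"
      "norm a \<le> real n" "norm b \<le> real n" "norm c \<le> real n"
      using s by (auto simp: T_def)
    obtain a' b' c' where abc': "t = a' + b' + c'" "a' \<in> M" "b' \<in> N" "c' \<in> S"
      "norm a' \<le> real n" "norm b' \<le> real n" "norm c' \<le> real n"
      using t by (auto simp: T_def)
    have bd: "norm (k *\<^sub>R (u - v)) \<le> C * norm x" if "norm u \<le> real n" "norm v \<le> real n" for u v :: 'a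
    proof -
      have "k * norm (u - v) \<le> k * (2 * real n)"
        using k that norm_triangle_ineq4[of u v] by (intro mult_left_mono) auto
      moreover have "k * (2 * real n) = C * norm x"
        by (simp add: C_def k_def)
      ultimately show ?thesis
        using k by simp
    qed
    have "norm (x /\<^sub>R k - (s - t)) \<le> r / 4"
    proof -
      have "x /\<^sub>R k - (s - t) = ((y + x /\<^sub>R k) - s) - (y - t)"
        by simp
      also have "norm \<dots> \<le> dist s (y + x /\<^sub>R k) + dist t y"
        by (metis dist_commute dist_norm norm_triangle_ineq4)
      finally show ?thesis
        using s t by simp
    qed
    then have "k * norm (x /\<^sub>R k - (s - t)) \<le> k * (r / 4)"
      using k by simp
    moreover have "x - k *\<^sub>R (a - a') - k *\<^sub>R (b - b') - k *\<^sub>R (c - c') = k *\<^sub>R (x /\<^sub>R k - (s - t))"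
      using k by (simp add: abc abc' algebra_simps)
    ultimately have "norm (x - k *\<^sub>R (a - a') - k *\<^sub>R (b - b') - k *\<^sub>R (c - c')) \<le> 1 / 2 * norm x"
      using k r by (simp add: k_def)
    then show ?thesis
      using abc abc' sub
      by (intro bexI[of _ "k *\<^sub>R (a - a')"] bexI[of _ "k *\<^sub>R (b - b')"]
          bexI[of _ "k *\<^sub>R (c - c')"] conjI bd scaleR_in_subspace subspace_diff)
  qed
  then have *: "\<exists>a\<in>M. \<exists>b\<in>N. \<exists>c\<in>S. x = a + b + c \<and>
     max (norm a) (max (norm b) (norm c)) \<le> C / (1 - 1 / 2) * norm x" for x
    by (rule successive_approximation[OF cl, rotated 2]) auto
  \<comment> \<open>The summand 1 keeps the constant positive when \<open>C = 0\<close>.\<close>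
  have "C / (1 - 1 / 2) * norm x \<le> (2 * C + 1) * norm x" for x :: 'a
    by (intro mult_right_mono) auto
  moreover have "2 * C + 1 > 0"
    using r by (simp add: C_def add_nonneg_pos)
  ultimately show ?thesis
    using * by (meson order_trans)
qed

section \<open>Complements of subspaces of finite codimension\<close>

lemma subspace_set_plus:
  "subspace M \<Longrightarrow> subspace N \<Longrightarrow> subspace (M + N)"
proof -
  assume "subspace M" "subspace N"
  moreover have "M + N = {x + y |x y. x \<in> M \<and> y \<in> N}"
    by (auto simp: set_plus_def)
  ultimately show ?thesis
    using subspace_sums by simp
qed

text \<open>A generator is added to \<open>C\<close> only if it lies outside
  \<open>L + span C\<close>. A nonzero common vector of \<open>L\<close> and the enlarged span would
  express the generator by \<open>L + span C\<close>.\<close>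

lemma exists_span_complement:
  assumes L: "subspace L" and "finite B"
  shows "\<exists>C. finite C \<and> L + span C = span (B \<union> L) \<and> L \<inter> span C = {0}"
  using assms(2)
proof induction
  case empty
  then show ?case
    using L by (intro exI[of _ "{}"]) (auto simp: set_plus_def subspace_0 span_eq_iff[THEN iffD2])
next
  case (insert b B)
  from insert.IH obtain C
    where C: "finite C" "L + span C = span (B \<union> L)" "L \<inter> span C = {0}"
    by (elim exE conjE)
  have eq: "L + span D = span (D \<union> L)" for D
  proof -
    have "span (D \<union> L) = span D + L"
      unfolding span_Un span_eq_iff[THEN iffD2, OF L] by (auto simp: set_plus_def)
    then show ?thesis
      by (simp add: add.commute)
  qed
  show ?case
  proof (cases "b \<in> L + span C")
    case True
    then show ?thesis
      using C by (intro exI[of _ C]) (simp add: span_redundant)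
  next
    case False
    have "x = 0" if x: "x \<in> L" "x \<in> span (insert b C)" for x
    proof -
      obtain k where k: "x - smul k b \<in> span C"
        using x span_breakdown_eq by blast
      have "k = 0"
      proof (rule ccontr)
        assume "k \<noteq> 0"
        then have "b = smul (inverse k) x + smul (- inverse k) (x - smul k b)"
          by (simp add: scale_right_diff_distrib)
        moreover have "smul (inverse k) x \<in> L" "smul (- inverse k) (x - smul k b) \<in> span C"
          using L x k by (auto intro!: subspace_scale span_scale simp del: scale_minus_left)
        ultimately show False
          using False by (metis set_plus_intro)
      qed
      then show ?thesis
        using k x C(3) by auto
    qed
    moreover have "L + span (insert b C) = span (insert b B \<union> L)"
      using C(2) unfolding eq by (simp add: span_insert)
    ultimately show ?thesis
      using C(1) L by (intro exI[of _ "insert b C"]) (auto simp: subspace_0 span_zero)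
  qed
qed

text \<open>The \<open>S\<close>-components of the generators \<open>B\<close> span
  \<open>S\<close>, because \<open>S\<close> meets \<open>L\<close> only in zero. So every
  complement of a subspace of finite codimension is finite-dimensional.\<close>

lemma complement_subset_span:
  assumes L: "subspace L" "finite B" "span (B \<union> L) = UNIV"
    and S: "subspace S" "L + S = UNIV" "L \<inter> S = {0}"
  shows "\<exists>C. finite C \<and> S \<subseteq> span C"
proof -
  have "\<exists>s\<in>S. b - s \<in> L" for b
  proof -
    obtain l s where "b = l + s" "l \<in> L" "s \<in> S"
      using S(2) by (metis UNIV_I set_plus_elim)
    then show ?thesis
      by (intro bexI[of _ s]) auto
  qed
  then obtain s where s: "\<And>b. s b \<in> S" "\<And>b. b - s b \<in> L"
    by metis
  have sub: "subspace (span (s ` B) + L)"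
    by (intro subspace_set_plus) (auto simp: L)
  have "b \<in> span (s ` B) + L" if "b \<in> B" for b
  proof -
    have "s b + (b - s b) \<in> span (s ` B) + L"
      using that s by (intro set_plus_intro) (auto simp: span_base)
    then show ?thesis by simp
  qed
  moreover have "L \<subseteq> span (s ` B) + L"
    using span_zero by (metis add.left_neutral set_plus_intro subsetI)
  ultimately have U: "span (s ` B) + L = UNIV"
    using span_minimal[OF _ sub, of "B \<union> L"] L(3) by auto
  have "x \<in> span (s ` B)" if x: "x \<in> S" for x
  proof -
    obtain u l where ul: "x = u + l" "u \<in> span (s ` B)" "l \<in> L"
      using U by (metis UNIV_I set_plus_elim)
    have "u \<in> S"
      using ul(2) s(1) S(1) span_minimal[of "s ` B" S] by auto
    then have "l \<in> S"
      using ul(1) x S(1) subspace_diff by (metis add_diff_cancel_left')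
    then have "l = 0"
      using ul(3) S(3) by blast
    then show ?thesis
      using ul by simp
  qed
  then show ?thesis
    using L(2) by blast
qed

lemma codim_le:
  assumes "finite B" "span (B \<union> L) = UNIV"
  shows "codim smul L \<le> enat (card B)"
  unfolding codim_def using assms by (intro INF_lower) auto

lemma codim_finiteE:
  assumes "codim smul L < \<infinity>"
  obtains B where "finite B" "span (B \<union> L) = UNIV"
proof -
  have "{B. finite B \<and> span (B \<union> L) = UNIV} \<noteq> {}"
  proof
    assume "{B. finite B \<and> span (B \<union> L) = UNIV} = {}"
    then have "codim smul L = \<infinity>"
      unfolding codim_def by (simp only: image_empty Inf_empty top_enat_def)
    then show False
      using assms by simp
  qed
  then show ?thesis
    using that by blast
qed

end

section \<open>The Hahn--Banach theorem\<close>

text \<open>Homogeneity is an inequality for positive factors only, which is easier to verify for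
  infima; the inverse factor gives equality in \<open>sublinear_scale\<close>.\<close>

definition sublinear :: "('v::real_vector \<Rightarrow> real) \<Rightarrow> bool" where
  "sublinear p \<longleftrightarrow> (\<forall>x y. p (x + y) \<le> p x + p y) \<and> (\<forall>r>0. \<forall>x. p (r *\<^sub>R x) \<le> r * p x)"

lemma sublinearD:
  assumes "sublinear p"
  shows "p (x + y) \<le> p x + p y" "r > 0 \<Longrightarrow> p (r *\<^sub>R x) \<le> r * p x"
  using assms by (auto simp: sublinear_def)

lemma sublinear_0:
  assumes "sublinear p"
  shows "p 0 = 0"
  using sublinearD(2)[OF assms, of 2 0] sublinearD(2)[OF assms, of "1/2" 0] by simp

lemma sublinear_minus_le:
  assumes "sublinear p"
  shows "- p (- x) \<le> p x"
  using sublinearD(1)[OF assms, of x "- x"] sublinear_0[OF assms] by simp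

lemma sublinear_scale:
  assumes "sublinear p" "r \<ge> 0"
  shows "p (r *\<^sub>R x) = r * p x"
proof (cases "r = 0")
  case False
  then have "p (inverse r *\<^sub>R r *\<^sub>R x) \<le> inverse r * p (r *\<^sub>R x)"
    using assms by (intro sublinearD) auto
  then have "r * p x \<le> p (r *\<^sub>R x)"
    using False assms(2) by (simp add: field_simps)
  then show ?thesis
    using sublinearD(2)[OF assms(1), of r x] False assms(2) by simp
qed (simp add: sublinear_0 assms)

text \<open>The conditions concern the family jointly, since it is applied to chains and also to the
  functionals \<open>v t\<close> of \<open>sublinear_directional\<close>, which are in general not
  sublinear themselves.\<close>

lemma sublinear_INF:
  fixes Q :: "('v::real_vector \<Rightarrow> real) set"
  assumes "Q \<noteq> {}" and bdd: "\<And>x. bdd_below ((\<lambda>q. q x) ` Q)"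
    and add: "\<And>q q' x y. q \<in> Q \<Longrightarrow> q' \<in> Q \<Longrightarrow> \<exists>q''\<in>Q. q'' (x + y) \<le> q x + q' y"
    and scale: "\<And>q r x. q \<in> Q \<Longrightarrow> r > 0 \<Longrightarrow> \<exists>q'\<in>Q. q' (r *\<^sub>R x) \<le> r * q x"
  shows "sublinear (\<lambda>x. INF q\<in>Q. q x)"
  unfolding sublinear_def
proof (intro conjI allI impI)
  fix x y
  have "(INF q\<in>Q. q (x + y)) \<le> q x + q' y" if q: "q \<in> Q" "q' \<in> Q" for q q'
  proof -
    obtain q'' where "q'' \<in> Q" "q'' (x + y) \<le> q x + q' y"
      using add[OF q] by blast
    then show ?thesis
      using cINF_lower[OF bdd] order_trans by blast
  qed
  then have "(INF q\<in>Q. q (x + y)) - q' y \<le> (INF q\<in>Q. q x)" if "q' \<in> Q" for q'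
    using assms(1) that by (intro cINF_greatest) (auto simp: algebra_simps)
  then have "(INF q\<in>Q. q (x + y)) - (INF q\<in>Q. q x) \<le> (INF q\<in>Q. q y)"
    using assms(1) by (intro cINF_greatest) (auto simp: algebra_simps)
  then show "(INF q\<in>Q. q (x + y)) \<le> (INF q\<in>Q. q x) + (INF q\<in>Q. q y)"
    by simp
next
  fix r :: real and x assume r: "r > 0"
  have "(INF q\<in>Q. q (r *\<^sub>R x)) / r \<le> q x" if q: "q \<in> Q" for q
  proof -
    obtain q' where "q' \<in> Q" "q' (r *\<^sub>R x) \<le> r * q x"
      using scale[OF q r] by blast
    then have "(INF q\<in>Q. q (r *\<^sub>R x)) \<le> r * q x"
      using cINF_lower[OF bdd] order_trans by blast
    then show ?thesis
      using r by (simp add: field_simps)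
  qed
  then have "(INF q\<in>Q. q (r *\<^sub>R x)) / r \<le> (INF q\<in>Q. q x)"
    using assms(1) by (intro cINF_greatest) auto
  then show "(INF q\<in>Q. q (r *\<^sub>R x)) \<le> r * (INF q\<in>Q. q x)"
    using r by (simp add: field_simps)
qed

text \<open>Minimizing \<open>p (x + t *\<^sub>R y) - t * p y\<close> over \<open>t \<ge> 0\<close>
  keeps sublinearity; \<open>t = 0\<close> and \<open>t = 1\<close> give the bounds. The bound by
  \<open>p (x + y) - p y\<close> forces additivity of minimal functionals, and the bound at
  \<open>- y\<close> fixes the value at a chosen point.\<close>

lemma sublinear_directional:
  fixes p :: "'v::real_vector \<Rightarrow> real"
  assumes p: "sublinear p"
  obtains q where "sublinear q" "\<And>x. q x \<le> p x" "\<And>x. q x \<le> p (x + y) - p y" "q (- y) \<le> - p y"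
proof -
  define v where "v t x = p (x + t *\<^sub>R y) - t * p y" for t x
  define Q where "Q = v ` {0..}"
  define q where "q x = (INF f\<in>Q. f x)" for x
  have "- p (- x) \<le> v t x" if "t \<ge> 0" for t x
    using sublinearD(1)[OF p, of "x + t *\<^sub>R y" "- x"] sublinear_scale[OF p that, of y]
    by (simp add: v_def)
  then have bdd: "bdd_below ((\<lambda>f. f x) ` Q)" for x
    by (intro bdd_belowI[of _ "- p (- x)"]) (auto simp: Q_def)
  have le: "q x \<le> v t x" if "t \<ge> 0" for t x
    unfolding q_def using that by (intro cINF_lower bdd) (auto simp: Q_def)
  have "sublinear q"
    unfolding q_def
  proof (rule sublinear_INF)
    show "\<exists>f''\<in>Q. f'' (x + z) \<le> f x + f' z" if f: "f \<in> Q" "f' \<in> Q" for f f' x z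
    proof -
      obtain s t where st: "f = v s" "s \<ge> 0" "f' = v t" "t \<ge> 0"
        using f by (auto simp: Q_def)
      have "v (s + t) (x + z) \<le> v s x + v t z"
        using sublinearD(1)[OF p, of "x + s *\<^sub>R y" "z + t *\<^sub>R y"]
        by (simp add: v_def algebra_simps)
      then show ?thesis
        using st by (intro bexI[of _ "v (s + t)"]) (auto simp: Q_def)
    qed
    show "\<exists>f'\<in>Q. f' (r *\<^sub>R x) \<le> r * f x" if f: "f \<in> Q" "r > 0" for f r x
    proof -
      obtain t where t: "f = v t" "t \<ge> 0"
        using f by (auto simp: Q_def)
      have "v (r * t) (r *\<^sub>R x) \<le> r * v t x"
        using sublinearD(2)[OF p f(2), of "x + t *\<^sub>R y"] by (simp add: v_def algebra_simps)
      then show ?thesis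
        using t f(2) by (intro bexI[of _ "v (r * t)"]) (auto simp: Q_def)
    qed
  qed (use bdd in \<open>auto simp: Q_def\<close>)
  moreover have "q x \<le> p x" "q x \<le> p (x + y) - p y" for x
    using le[of 0 x] le[of 1 x] by (auto simp: v_def)
  moreover have "q (- y) \<le> - p y"
    using le[of 1 "- y"] sublinear_0[OF p] by (simp add: v_def)
  ultimately show thesis
    using that by blast
qed

text \<open>
  A sublinear functional that is minimal for the pointwise order is linear: by minimality it
  coincides with its directional modifications, which gives \<open>m x \<le> m (x + y) - m y\<close>.
\<close>

lemma exists_linear_le_sublinear:
  fixes p :: "'v::real_vector \<Rightarrow> real"
  assumes p: "sublinear p"
  obtains u where "linear u" "\<And>x. u x \<le> p x"
proof -
  define A where "A = {q. sublinear q \<and> (\<forall>x. q x \<le> p x)}"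
  \<comment> \<open>The order is reversed so that the maximal element from Zorn's lemma is a minimal
    functional.\<close>
  define P where "P = (\<lambda>q q' :: 'v \<Rightarrow> real. \<forall>x. q' x \<le> q x)"
  have "\<exists>m\<in>A. \<forall>a\<in>A. P m a \<longrightarrow> a = m"
  proof (rule predicate_Zorn)
    show "partial_order_on A (relation_of P A)"
      by (intro partial_order_on_relation_ofI) (auto simp: P_def fun_eq_iff intro: order_trans antisym)
    fix C assume C: "C \<in> Chains (relation_of P A)"
    then have CA: "C \<subseteq> A" and comp: "\<And>q q'. q \<in> C \<Longrightarrow> q' \<in> C \<Longrightarrow> P q q' \<or> P q' q"
      by (auto simp: Chains_def relation_of_def)
    show "\<exists>u\<in>A. \<forall>a\<in>C. P a u"
    proof (cases "C = {}")
      case True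
      then show ?thesis
        using p by (auto simp: A_def)
    next
      case False
      \<comment> \<open>This lower bound is common to the whole chain, so its pointwise infimum is
        finite.\<close>
      have "- p (- x) \<le> q x" if "q \<in> C" for q x
      proof -
        have "sublinear q" "q (- x) \<le> p (- x)"
          using that CA by (auto simp: A_def)
        then show ?thesis
          using sublinear_minus_le[of q x] by simp
      qed
      then have bdd: "bdd_below ((\<lambda>q. q x) ` C)" for x
        by (intro bdd_belowI[of _ "- p (- x)"]) auto
      have low: "(INF q\<in>C. q x) \<le> q x" if "q \<in> C" for q x
        using that by (intro cINF_lower bdd)
      have "sublinear (\<lambda>x. INF q\<in>C. q x)"
      proof (rule sublinear_INF[OF False bdd])
        show "\<exists>q''\<in>C. q'' (x + y) \<le> q x + q' y" if q: "q \<in> C" "q' \<in> C" for q q' x y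
        proof -
          have "sublinear q" "sublinear q'"
            using q CA by (auto simp: A_def)
          then have "q (x + y) \<le> q x + q y" "q' (x + y) \<le> q' x + q' y"
            by (simp_all add: sublinearD)
          \<comment> \<open>In a chain the smaller of the two functionals serves for both
            summands.\<close>
          moreover have "q y \<le> q' y \<or> q' x \<le> q x"
            using comp[OF q] by (auto simp: P_def)
          ultimately show ?thesis
            using q by (meson add_left_mono add_right_mono order_trans)
        qed
        show "\<exists>q'\<in>C. q' (r *\<^sub>R x) \<le> r * q x" if "q \<in> C" "r > 0" for q r x
          using that CA by (intro bexI[of _ q] sublinearD(2)) (auto simp: A_def)
      qed
      moreover have "(INF q\<in>C. q x) \<le> p x" for x
      proof -
        obtain q where "q \<in> C"
          using False by blast
        moreover from this have "q x \<le> p x"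
          using CA by (auto simp: A_def)
        ultimately show ?thesis
          using low[of q x] by linarith
      qed
      ultimately show ?thesis
        using low by (intro bexI[of _ "\<lambda>x. INF q\<in>C. q x"]) (auto simp: A_def P_def)
    qed
  qed
  then obtain m where "m \<in> A" and min: "\<And>q. q \<in> A \<Longrightarrow> P m q \<Longrightarrow> q = m"
    by blast
  then have m: "sublinear m" and mp: "\<And>x. m x \<le> p x"
    by (auto simp: A_def)
  have add: "m (x + y) = m x + m y" for x y
  proof -
    obtain q where q: "sublinear q" "\<And>x. q x \<le> m x" "\<And>x. q x \<le> m (x + y) - m y"
      using sublinear_directional[OF m] by metis
    then have "q \<in> A" "P m q"
      using mp by (auto simp: A_def P_def intro: order_trans)
    then have "q = m"
      by (rule min)
    then show ?thesis
      using q(3)[of x] sublinearD(1)[OF m, of x y] by simp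
  qed
  then have "m (x + - x) = m x + m (- x)" for x
    by blast
  then have neg: "m (- x) = - m x" for x
    using sublinear_0[OF m] by (simp add: eq_neg_iff_add_eq_0 add.commute)
  have "m (r *\<^sub>R x) = r * m x" for r x
  proof (cases "r \<ge> 0")
    case False
    have "m (r *\<^sub>R x) = - m ((- r) *\<^sub>R x)"
      using neg[of "r *\<^sub>R x"] by simp
    also have "\<dots> = r * m x"
      using False sublinear_scale[OF m, of "- r" x] by simp
    finally show ?thesis .
  qed (simp add: sublinear_scale[OF m])
  then have "linear m"
    by (intro linearI) (auto simp: add)
  then show thesis
    using mp that by blast
qed

text \<open>A linear functional below the modification in direction \<open>x0\<close> has value at
  most \<open>- p x0\<close> at \<open>- x0\<close>, which together with \<open>u \<le> p\<close>
  forces equality at \<open>x0\<close>.\<close>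

theorem hahn_banach_sublinear:
  fixes p :: "'v::real_vector \<Rightarrow> real"
  assumes p: "sublinear p"
  obtains u where "linear u" "\<And>x. u x \<le> p x" "u x0 = p x0"
proof -
  obtain q where q: "sublinear q" "\<And>x. q x \<le> p x" "q (- x0) \<le> - p x0"
    using sublinear_directional[OF p] by metis
  obtain u where u: "linear u" "\<And>x. u x \<le> q x"
    using exists_linear_le_sublinear[OF q(1)] by metis
  have "- u x0 \<le> - p x0"
    using u(2)[of "- x0"] q(3) linear_neg[OF u(1)] by simp
  moreover have le: "u x \<le> p x" for x
    using u(2) q(2) by (rule order_trans)
  ultimately show thesis
    using that u(1) by (metis antisym neg_le_iff_le)
qed

section \<open>Functionals with values in the scalar field\<close>

lemma field_functional_unique:
  fixes a a' :: "'k::{real_normed_field, euclidean_space}"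
  assumes "\<And>c. inner (c * a) 1 = inner (c * a') 1"
  shows "a = a'"
proof (rule ccontr)
  assume "a \<noteq> a'"
  then have "inner (inverse (a - a') * (a - a')) 1 = (1 :: real)"
    by (simp add: dot_square_norm)
  then show False
    using assms[of "inverse (a - a')"] by (simp add: right_diff_distrib inner_diff_left)
qed

text \<open>
  The trace-like form \<open>(c, a) \<mapsto> inner (c * a) 1\<close> identifies the field with its real dual, so that
  real functionals on a space over the field come from functionals with values in the field.
\<close>

lemma field_functional_exists:
  fixes g :: "'k::{real_normed_field, euclidean_space} \<Rightarrow> real"
  assumes g: "linear g"
  shows "\<exists>a. \<forall>c. inner (c * a) 1 = g c"
proof -
  \<comment> \<open>\<open>T a\<close> is the Riesz vector of the functional
    \<open>c \<mapsto> inner (c * a) 1\<close>. Nondegeneracy makes \<open>T\<close> injective,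
    hence onto by finite dimension.\<close>
  define T :: "'k \<Rightarrow> 'k" where "T a = (\<Sum>b\<in>Basis. inner (b * a) 1 *\<^sub>R b)" for a
  have lin: "linear (\<lambda>c. inner (c * a) 1)" for a :: 'k
    by (intro linearI) (simp_all add: distrib_right inner_add_left)
  have T: "inner (T a) b = inner (b * a) 1" if "b \<in> Basis" for a b
    using that by (simp add: T_def)
  have eqI: "inner (c * a) 1 = h c" if "linear h" "\<And>b. b \<in> Basis \<Longrightarrow> inner (T a) b = h b" for h a c
  proof -
    have "(\<lambda>c. inner (c * a) 1) = h"
      using that T by (intro linear_eq_stdbasis lin) auto
    then show ?thesis
      by metis
  qed
  have linT: "linear T"
    by (intro linearI)
      (simp_all add: T_def distrib_left inner_add_left scaleR_left_distrib sum.distrib scaleR_sum_right)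
  moreover have "inj T"
    unfolding linear_inj_iff_eq_0[OF linT]
  proof (intro allI impI)
    fix a assume "T a = 0"
    then have "inner (c * a) 1 = 0" for c
      by (intro eqI[of "\<lambda>_. 0"]) (auto simp: linear_zero)
    then have "inner (c * a) 1 = inner (c * 0) 1" for c
      by simp
    then show "a = 0"
      by (rule field_functional_unique)
  qed
  ultimately have "surj T"
    by (rule linear_injective_imp_surjective) (rule refl)
  then obtain a where a: "T a = (\<Sum>b\<in>Basis. g b *\<^sub>R b)"
    by (metis surjD)
  then have "inner (c * a) 1 = g c" for c
    using g by (intro eqI) auto
  then show ?thesis
    by blast
qed

context banach_over
begin

lemma smul_scaleR: "smul (r *\<^sub>R c) x = r *\<^sub>R smul c x"
  by (metis scaleR_conv_of_real scale_of_real scale_scale)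

text \<open>The real functional \<open>u\<close> from the sublinear case determines \<open>f\<close>
  through \<open>inner (c * f x) 1 = u (smul c x)\<close>; uniqueness of the representing scalar
  makes \<open>f\<close> linear over the field.\<close>

theorem hahn_banach_seminorm:
  assumes add: "\<And>x y. p (x + y) \<le> p x + p y"
    and scale: "\<And>c x. p (smul c x) \<le> norm c * p x"
    and le: "\<And>x. p x \<le> norm x"
  obtains f where "f \<in> dual smul" "\<And>x. norm (blinfun_apply f x) \<le> p x" "p x0 \<le> norm (blinfun_apply f x0)"
proof -
  have "sublinear p"
    unfolding sublinear_def
  proof (intro conjI allI impI add)
    show "p (r *\<^sub>R x) \<le> r * p x" if "r > 0" for r x
      using scale[of "of_real r" x] that by (simp add: scale_of_real)
  qed
  then obtain u where u: "linear u" "\<And>x. u x \<le> p x" "u x0 = p x0"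
    using hahn_banach_sublinear by metis
  have "linear (\<lambda>c. u (smul c x))" for x
    by (intro linearI)
      (simp_all add: smul_scaleR scale_left_distrib linear_add[OF u(1)] linear_scale[OF u(1)])
  then have "\<exists>a. \<forall>c. inner (c * a) 1 = u (smul c x)" for x
    by (rule field_functional_exists)
  then obtain f where f: "\<And>x c. inner (c * f x) 1 = u (smul c x)"
    by metis
  have f_add: "f (x + y) = f x + f y" for x y
    by (rule field_functional_unique)
      (simp add: f scale_right_distrib distrib_left inner_add_left linear_add[OF u(1)])
  have f_smul: "f (smul d x) = d * f x" for d x
    by (rule field_functional_unique) (metis f scale_scale mult.assoc)
  have f_le: "norm (f x) \<le> p x" for x
  proof (cases "f x = 0")
    case True
    have "p x \<ge> 0"
      using add[of x "- x"] scale[of "-1" x] scale[of 0 x] add[of 0 0] by simp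
    then show ?thesis
      using True by simp
  next
    case False
    \<comment> \<open>Rescaling by \<open>inverse (f x)\<close> turns the one-sided real estimate
      \<open>u \<le> p\<close> into a bound on the norm of \<open>f x\<close>.\<close>
    have "1 = u (smul (inverse (f x)) x)"
      using f[of "inverse (f x)" x] False by (simp add: dot_square_norm)
    also have "\<dots> \<le> p (smul (inverse (f x)) x)"
      by (rule u(2))
    also have "\<dots> \<le> norm (inverse (f x)) * p x"
      by (rule scale)
    also have "\<dots> = p x / norm (f x)"
      by (simp add: norm_inverse divide_inverse mult.commute)
    finally show ?thesis
      using False by (simp add: pos_le_divide_eq)
  qed
  have "f (r *\<^sub>R x) = r *\<^sub>R f x" for r x
    using f_smul[of "of_real r" x] by (simp add: scale_of_real scaleR_conv_of_real)
  then have "bounded_linear f"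
    using f_add order_trans[OF f_le le] by (intro bounded_linear_intro[of _ 1]) auto
  then have app: "blinfun_apply (Blinfun f) = f"
    by (rule bounded_linear_Blinfun_apply)
  have "p x0 = inner (f x0) 1"
    using f[of 1 x0] u(3) by simp
  also have "\<dots> \<le> norm (f x0)"
    using norm_cauchy_schwarz[of "f x0" 1] by simp
  finally show thesis
    using that[of "Blinfun f"] f_smul f_le by (simp add: app dual_def)
qed

end

section \<open>Almost annihilating functionals\<close>

text \<open>Functionals form a space of the same kind, so closedness, compactness and independence
  results also apply to spans of functionals. The lower norm bound is the upper one for the inverse
  scalar.\<close>

interpretation dual_space: banach_over
  "dual_scale :: 'k::{real_normed_field, euclidean_space} \<Rightarrow> ('a::banach \<Rightarrow>\<^sub>L 'k) \<Rightarrow> ('a \<Rightarrow>\<^sub>L 'k)"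
proof (intro banach_over.intro banach_over_axioms.intro vector_space_dual_scale)
  fix c :: 'k and f :: "'a \<Rightarrow>\<^sub>L 'k"
  have le: "norm (dual_scale d g) \<le> norm d * norm g" for d :: 'k and g :: "'a \<Rightarrow>\<^sub>L 'k"
    by (rule norm_blinfun_bound)
      (auto simp: dual_scale_apply norm_mult mult.assoc intro!: mult_left_mono norm_blinfun)
  have "norm c * norm f \<le> norm (dual_scale c f)" if "c \<noteq> 0"
  proof -
    have "dual_scale (inverse c) (dual_scale c f) = f"
      using that by (intro blinfun_eqI) (simp add: dual_scale_apply)
    then have "norm f \<le> norm (inverse c) * norm (dual_scale c f)"
      using le[of "inverse c" "dual_scale c f"] by simp
    then show ?thesis
      using that by (simp add: norm_inverse pos_le_divide_eq divide_inverse_commute[symmetric] mult.commute)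
  qed
  then show "norm (dual_scale c f) = norm c * norm f"
    using le[of c f] by (cases "c = 0") auto
  show "dual_scale (of_real r) f = r *\<^sub>R f" for r
    by (rule blinfun_eqI) (simp add: dual_scale_apply scaleR_blinfun.rep_eq scaleR_conv_of_real)
qed

context banach_over
begin

lemma subspace_annihilator: "dual_space.subspace (annihilator smul M)"
  by (auto simp: dual_space.subspace_def annihilator_def dual_def plus_blinfun.rep_eq
      dual_scale_apply distrib_left mult.left_commute)

text \<open>
  The functional comes from the Hahn--Banach theorem for the seminorm
  \<open>p x = inf {norm (x - a - b) + e * norm b | a \<in> P, b \<in> Q}\<close>. If \<open>p x \<le> norm x / 2\<close>
  held for all \<open>x\<close>, then successive approximation would give \<open>P + Q = UNIV\<close>.
\<close>

lemma exists_almost_annihilating_functional: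
  assumes P: "closed_subspace smul P" and Q: "closed_subspace smul Q"
    and ne: "P + Q \<noteq> UNIV" and e: "e > 0"
  obtains f x where "f \<in> annihilator smul P" "\<And>b. b \<in> Q \<Longrightarrow> norm (blinfun_apply f b) \<le> e * norm b"
    "norm f \<le> 1" "norm x = 1" "norm (blinfun_apply f x) \<ge> 1 / 2"
proof -
  have sub: "subspace P" "subspace Q"
    using P Q by (auto simp: closed_subspace_def)
  define v :: "'a \<times> 'a \<Rightarrow> 'a \<Rightarrow> real"
    where "v = (\<lambda>(a, b) x. norm (x - a - b) + e * norm b)"
  define p where "p x = (INF ab\<in>P \<times> Q. v ab x)" for x
  have 0: "(0, 0) \<in> P \<times> Q"
    using sub by (simp add: subspace_0)
  have bdd: "bdd_below ((\<lambda>ab. v ab x) ` (P \<times> Q))" for x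
    using e by (intro bdd_belowI[of _ 0]) (auto simp: v_def)
  have low: "p x \<le> v (a, b) x" if "a \<in> P" "b \<in> Q" for a b x
    unfolding p_def using that by (intro cINF_lower bdd) auto
  have great: "m \<le> p x" if "\<And>a b. a \<in> P \<Longrightarrow> b \<in> Q \<Longrightarrow> m \<le> v (a, b) x" for m x
    unfolding p_def using that 0 by (intro cINF_greatest) auto
  have p_le: "p x \<le> norm x" for x
    using low[of 0 0 x] 0 by (simp add: v_def)
  have p_add: "p (x + y) \<le> p x + p y" for x y
  proof -
    have *: "p (x + y) \<le> v (a, b) x + v (a', b') y" if "a \<in> P" "b \<in> Q" "a' \<in> P" "b' \<in> Q" for a b a' b'
    proof -
      have "p (x + y) \<le> v (a + a', b + b') (x + y)"
        using that sub by (intro low subspace_add)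
      also have "\<dots> = norm ((x - a - b) + (y - a' - b')) + e * norm (b + b')"
        by (simp add: v_def algebra_simps)
      also have "\<dots> \<le> (norm (x - a - b) + norm (y - a' - b')) + e * (norm b + norm b')"
        using e by (intro add_mono mult_left_mono norm_triangle_ineq) auto
      finally show ?thesis
        by (simp add: v_def algebra_simps)
    qed
    have "p (x + y) - v (a', b') y \<le> p x" if "a' \<in> P" "b' \<in> Q" for a' b'
      by (rule great) (use * that in \<open>simp add: algebra_simps\<close>)
    then have "p (x + y) - p x \<le> p y"
      by (intro great) (simp add: algebra_simps)
    then show ?thesis
      by simp
  qed
  have p_scale: "p (smul c x) \<le> norm c * p x" for c x
  proof (cases "c = 0")
    case True
    then show ?thesis
      using p_le[of 0] by simp
  next
    case False
    have "p (smul c x) / norm c \<le> p x"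
    proof (rule great)
      fix a b assume ab: "a \<in> P" "b \<in> Q"
      have "p (smul c x) \<le> v (smul c a, smul c b) (smul c x)"
        using ab sub by (intro low subspace_scale)
      also have "\<dots> = norm (smul c (x - a - b)) + e * norm (smul c b)"
        by (simp add: v_def scale_right_diff_distrib)
      also have "\<dots> = norm c * v (a, b) x"
        by (simp add: v_def norm_scale distrib_left mult.left_commute)
      finally show "p (smul c x) / norm c \<le> v (a, b) x"
        using False by (simp add: pos_divide_le_eq mult.commute)
    qed
    then show ?thesis
      using False by (simp add: pos_divide_le_eq mult.commute)
  qed
  have "\<exists>x. p x > norm x / 2"
  proof (rule ccontr)
    assume "\<not> ?thesis"
    then have half: "p x \<le> norm x / 2" for x
      by (simp add: not_less)
    \<comment> \<open>A near-minimizing pair has \<open>e * norm b \<le> norm x\<close>, whence the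
      term \<open>1 / e\<close>; writing \<open>a\<close> as \<open>x - b\<close> minus the
      remainder costs at most \<open>2 * norm x\<close> more.\<close>
    define C where "C = 2 + 1 / e"
    have "\<exists>a\<in>P. \<exists>b\<in>Q. \<exists>c\<in>{0}. norm a \<le> C * norm x \<and> norm b \<le> C * norm x \<and>
        norm c \<le> C * norm x \<and> norm (x - a - b - c) \<le> 3 / 4 * norm x" for x
    proof (cases "x = 0")
      case True
      then show ?thesis
        using 0 by (auto intro!: bexI[of _ 0])
    next
      case False
      have C: "C \<ge> 0"
        using e by (simp add: C_def)
      have "norm x > 0"
        using False by simp
      \<comment> \<open>The room between \<open>1 / 2\<close> and \<open>3 / 4\<close> allows a pair
        that only nearly attains the infimum.\<close>
      then have "p x < 3 / 4 * norm x"
        using half[of x] by linarith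
      then obtain a b where ab: "a \<in> P" "b \<in> Q" "v (a, b) x < 3 / 4 * norm x"
        using great[of "3 / 4 * norm x" x] by (meson not_le)
      then have *: "norm (x - a - b) + e * norm b \<le> 3 / 4 * norm x"
        by (simp add: v_def)
      moreover have "e * norm b \<ge> 0"
        using e by simp
      ultimately have r: "norm (x - a - b) \<le> 3 / 4 * norm x" and "e * norm b \<le> norm x"
        using norm_ge_zero[of x] norm_ge_zero[of "x - a - b"] by linarith+
      then have b: "norm b \<le> 1 / e * norm x"
        using e by (simp add: field_simps)
      have "norm a = norm (x - b - (x - a - b))"
        by simp
      then have "norm a \<le> norm x + norm b + norm (x - a - b)"
        using norm_triangle_ineq4[of "x - b" "x - a - b"] norm_triangle_ineq4[of x b] by linarith
      moreover have "C * norm x = 2 * norm x + 1 / e * norm x"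
        by (simp add: C_def distrib_right)
      ultimately have "norm a \<le> C * norm x" "norm b \<le> C * norm x"
        using b r norm_ge_zero[of x] by linarith+
      then show ?thesis
        using ab r C by (intro bexI[of _ a] bexI[of _ b] bexI[of _ 0]) auto
    qed
    moreover have "closed_subspace smul {0}"
      by (simp add: closed_subspace_def subspace_single_0)
    ultimately have "\<exists>a\<in>P. \<exists>b\<in>Q. \<exists>c\<in>{0}. x = a + b + c \<and>
        max (norm a) (max (norm b) (norm c)) \<le> C / (1 - 3 / 4) * norm x" for x
      using P Q by (intro successive_approximation) auto
    then have "x \<in> P + Q" for x
      by (metis add.right_neutral set_plus_intro singletonD)
    then show False
      using ne by blast
  qed
  then obtain x where x: "p x > norm x / 2"
    by blast
  obtain f where f: "f \<in> dual smul" "\<And>x. norm (blinfun_apply f x) \<le> p x"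
      "p x \<le> norm (blinfun_apply f x)"
    using hahn_banach_seminorm[of p x] p_add p_scale p_le by metis
  have "x \<noteq> 0"
    using x p_le[of 0] by auto
  show thesis
  proof
    \<comment> \<open>The pair \<open>(a, 0)\<close> gives \<open>p a \<le> 0\<close> on
      \<open>P\<close>; below, the pair \<open>(0, b)\<close> gives
      \<open>p b \<le> e * norm b\<close> on \<open>Q\<close>.\<close>
    have "blinfun_apply f a = 0" if "a \<in> P" for a
      using order_trans[OF f(2) low[of a 0 a]] that 0 by (simp add: v_def)
    then show "f \<in> annihilator smul P"
      using f(1) by (simp add: annihilator_def)
    show "norm (blinfun_apply f b) \<le> e * norm b" if "b \<in> Q" for b
      using order_trans[OF f(2) low[of 0 b b]] that 0 by (simp add: v_def)
    show "norm f \<le> 1"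
      using order_trans[OF f(2) p_le] by (intro norm_blinfun_bound) auto
    show "norm (x /\<^sub>R norm x) = 1"
      using \<open>x \<noteq> 0\<close> by simp
    show "norm (blinfun_apply f (x /\<^sub>R norm x)) \<ge> 1 / 2"
      using \<open>x \<noteq> 0\<close> x f(3) by (simp add: blinfun.scaleR_right field_simps)
  qed
qed

text \<open>
  The functionals form a triangular system: each new one vanishes on the test vectors \<open>X\<close> of the
  previous ones. So the coefficients, and thus the norm, of an element \<open>w\<close> of the span are bounded
  in terms of \<open>m\<close>, the size of \<open>w\<close> on \<open>X\<close>.
\<close>

lemma exists_almost_annihilating_system:
  assumes P: "closed_subspace smul P" and Q: "closed_subspace smul Q"
    and codim: "\<forall>B. finite B \<and> card B < n \<longrightarrow> span (B \<union> (P + Q)) \<noteq> UNIV" and "e > 0"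
  shows "\<exists>F X D. finite F \<and> card F = n \<and> F \<subseteq> annihilator smul P \<and> dual_space.independent F \<and>
    finite X \<and> card X \<le> n \<and> (\<forall>x\<in>X. norm x = 1) \<and> D \<ge> 0 \<and>
    (\<forall>w\<in>dual_space.span F. \<forall>m\<ge>0. (\<forall>x\<in>X. norm (blinfun_apply w x) \<le> m) \<longrightarrow>
       norm w \<le> D * m \<and> (\<forall>b\<in>Q. norm (blinfun_apply w b) \<le> e * m * norm b))"
  using codim \<open>e > 0\<close>
proof (induction n arbitrary: e)
  case 0
  show ?case
    by (intro exI[of _ "{}"] exI[of _ 0]) (use 0 in \<open>auto simp: dual_space.independent_empty\<close>)
next
  case (Suc n)
  \<comment> \<open>Half of the tolerance goes to the old functionals, half to the new one.\<close>
  have "\<forall>B. finite B \<and> card B < n \<longrightarrow> span (B \<union> (P + Q)) \<noteq> UNIV" "e / 2 > 0"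
    using Suc.prems by auto
  from Suc.IH[OF this] obtain F X D
    where F: "finite F" "card F = n" "F \<subseteq> annihilator smul P" "dual_space.independent F"
      and X: "finite X" "card X \<le> n" "\<forall>x\<in>X. norm x = 1" and D: "D \<ge> 0"
      and w': "\<forall>w\<in>dual_space.span F. \<forall>m\<ge>0. (\<forall>x\<in>X. norm (blinfun_apply w x) \<le> m) \<longrightarrow>
        norm w \<le> D * m \<and> (\<forall>b\<in>Q. norm (blinfun_apply w b) \<le> e / 2 * m * norm b)"
    by (elim exE conjE)
  have w: "norm w \<le> D * m \<and> (\<forall>b\<in>Q. norm (blinfun_apply w b) \<le> e / 2 * m * norm b)"
    if "w \<in> dual_space.span F" "m \<ge> 0" "\<And>x. x \<in> X \<Longrightarrow> norm (blinfun_apply w x) \<le> m" for w m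
    using w' that by simp
  have sub: "subspace P" "subspace Q"
    using P Q by (auto simp: closed_subspace_def)
  have "closed_subspace smul (span (X \<union> P))"
    unfolding closed_subspace_def using closed_span_Un[of P X] P X
    by (auto simp: closed_subspace_def)
  \<comment> \<open>Otherwise the at most \<open>n\<close> vectors of \<open>X\<close> together with
    \<open>P + Q\<close> would span the space.\<close>
  moreover have "span (X \<union> P) + Q \<noteq> UNIV"
  proof -
    have "P \<subseteq> P + Q" "Q \<subseteq> P + Q"
      using sub subspace_0 by (metis add.right_neutral add.left_neutral set_plus_intro subsetI)+
    then have "span (X \<union> P) \<subseteq> span (X \<union> (P + Q))" "Q \<subseteq> span (X \<union> (P + Q))"
      using span_superset[of "X \<union> (P + Q)"] by (auto intro!: span_mono)
    then have "span (X \<union> P) + Q \<subseteq> span (X \<union> (P + Q))"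
      by (auto simp: set_plus_def intro!: span_add)
    then show ?thesis
      using Suc.prems(1) X by (metis less_Suc_eq_le top.extremum_unique)
  qed
  \<comment> \<open>The coefficient of the new functional will be at most
    \<open>2 * (1 + D) * m\<close>, so this tolerance contributes exactly
    \<open>e / 2 * m\<close>.\<close>
  moreover have e: "e / (4 * (1 + D)) > 0"
    using Suc.prems D by simp
  ultimately obtain f y
    where f: "f \<in> annihilator smul (span (X \<union> P))" "norm f \<le> 1"
        "\<And>b. b \<in> Q \<Longrightarrow> norm (blinfun_apply f b) \<le> e / (4 * (1 + D)) * norm b"
      and y: "norm y = 1" "norm (blinfun_apply f y) \<ge> 1 / 2"
    using exists_almost_annihilating_functional[OF _ Q] by metis
  have fP: "f \<in> annihilator smul P" and fX: "\<And>x. x \<in> X \<Longrightarrow> blinfun_apply f x = 0"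
    using f(1) span_superset[of "X \<union> P"] by (auto simp: annihilator_def)
  \<comment> \<open>An element of the old span that vanishes on \<open>X\<close> is zero, by the
    bound with \<open>m = 0\<close>, but \<open>f\<close> is nonzero at \<open>y\<close>.\<close>
  have notin: "f \<notin> dual_space.span F"
  proof
    assume "f \<in> dual_space.span F"
    then have "norm f \<le> D * 0"
      using w[of f 0] fX by simp
    then show False
      using y by simp
  qed
  define D' where "D' = D + 2 * (1 + D)"
  have main: "norm g \<le> D' * m \<and> (\<forall>b\<in>Q. norm (blinfun_apply g b) \<le> e * m * norm b)"
    if g: "g \<in> dual_space.span (insert f F)" and m: "m \<ge> 0"
      and le': "\<forall>x\<in>insert y X. norm (blinfun_apply g x) \<le> m" for g m
  proof -
    have le: "norm (blinfun_apply g x) \<le> m" if "x \<in> insert y X" for x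
      using le' that by blast
    obtain c where c: "g - dual_scale c f \<in> dual_space.span F"
      using g dual_space.span_breakdown_eq by blast
    define h where "h = g - dual_scale c f"
    have g_eq: "g = h + dual_scale c f"
      by (simp add: h_def)
    have app: "blinfun_apply g x = blinfun_apply h x + c * blinfun_apply f x" for x
      by (simp add: g_eq plus_blinfun.rep_eq dual_scale_apply)
    have "norm (blinfun_apply h x) \<le> m" if "x \<in> X" for x
      using le[of x] app[of x] fX[OF that] that by simp
    then have h: "norm h \<le> D * m" "\<And>b. b \<in> Q \<Longrightarrow> norm (blinfun_apply h b) \<le> e / 2 * m * norm b"
      using w[of h m] c m by (auto simp: h_def)
    \<comment> \<open>Evaluation at \<open>y\<close>, where \<open>f\<close> has size at least
      \<open>1 / 2\<close>, controls the coefficient \<open>c\<close>.\<close>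
    have "norm c * (1 / 2) \<le> norm c * norm (blinfun_apply f y)"
      using y by (intro mult_left_mono) auto
    also have "\<dots> = norm (blinfun_apply g y - blinfun_apply h y)"
      by (simp add: app norm_mult)
    also have "\<dots> \<le> m + D * m"
      using le[of y] norm_blinfun[of h y] h(1) y(1) by (intro norm_triangle_le_diff) auto
    finally have c_le: "norm c \<le> 2 * (1 + D) * m"
      by (simp add: algebra_simps)
    have "norm g \<le> norm h + norm c * norm f"
      unfolding g_eq by (metis norm_triangle_ineq dual_space.norm_scale)
    also have "\<dots> \<le> D * m + norm c * 1"
      using h(1) f(2) by (intro add_mono mult_left_mono) auto
    finally have "norm g \<le> D' * m"
      using c_le by (simp add: D'_def distrib_right)
    moreover have "norm (blinfun_apply g b) \<le> e * m * norm b" if "b \<in> Q" for b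
    proof -
      have "norm c * norm (blinfun_apply f b) \<le> (2 * (1 + D) * m) * (e / (4 * (1 + D)) * norm b)"
        using c_le f(3)[OF that] D m by (intro mult_mono) auto
      also have "\<dots> = e / 2 * m * norm b"
        using D by (simp add: field_simps)
      finally have "norm (c * blinfun_apply f b) \<le> e / 2 * m * norm b"
        by (simp add: norm_mult)
      then have "norm (blinfun_apply g b) \<le> e / 2 * m * norm b + e / 2 * m * norm b"
        unfolding app by (intro norm_triangle_mono h that)
      then show ?thesis
        by simp
    qed
    ultimately show ?thesis
      by blast
  qed
  then have main': "\<forall>g\<in>dual_space.span (insert f F). \<forall>m\<ge>0.
      (\<forall>x\<in>insert y X. norm (blinfun_apply g x) \<le> m) \<longrightarrow>
      norm g \<le> D' * m \<and> (\<forall>b\<in>Q. norm (blinfun_apply g b) \<le> e * m * norm b)"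
    by simp
  have "f \<notin> F"
    using notin dual_space.span_base by blast
  then have "card (insert f F) = Suc n"
    using F by simp
  moreover have "card (insert y X) \<le> Suc n"
    using X by (simp add: card_insert_if)
  moreover have "D' \<ge> 0"
    using D by (simp add: D'_def)
  moreover have "dual_space.independent (insert f F)"
    using notin F(4) by (rule dual_space.independent_insertI)
  ultimately show ?case
    using F X y(1) fP
    by (intro exI[of _ "insert f F"] exI[of _ "insert y X"] exI[of _ D'] conjI main') auto
qed

text \<open>The test vectors of the system are unit vectors, so \<open>m = norm w\<close> is
  admissible and they disappear from the estimate.\<close>

lemma exists_almost_annihilating_space:
  assumes P: "closed_subspace smul P" and Q: "closed_subspace smul Q"
    and codim: "enat n \<le> codim smul (P + Q)" and "e > 0"
  obtains F where "finite F" "card F = n" "F \<subseteq> annihilator smul P" "dual_space.independent F"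
    "\<And>w b. w \<in> dual_space.span F \<Longrightarrow> b \<in> Q \<Longrightarrow> norm (blinfun_apply w b) \<le> e * norm w * norm b"
proof -
  have "\<forall>B. finite B \<and> card B < n \<longrightarrow> span (B \<union> (P + Q)) \<noteq> UNIV"
    using codim order_trans[OF codim codim_le] by fastforce
  from exists_almost_annihilating_system[OF P Q this \<open>e > 0\<close>] obtain F X D
    where F: "finite F" "card F = n" "F \<subseteq> annihilator smul P" "dual_space.independent F"
      and X: "\<forall>x\<in>X. norm x = 1"
      and w: "\<forall>w\<in>dual_space.span F. \<forall>m\<ge>0. (\<forall>x\<in>X. norm (blinfun_apply w x) \<le> m) \<longrightarrow>
        norm w \<le> D * m \<and> (\<forall>b\<in>Q. norm (blinfun_apply w b) \<le> e * m * norm b)"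
    by (elim exE conjE)
  have "norm (blinfun_apply w b) \<le> e * norm w * norm b"
    if wF: "w \<in> dual_space.span F" and "b \<in> Q" for w b
  proof -
    have "norm (blinfun_apply w x) \<le> norm w" if "x \<in> X" for x
      using norm_blinfun[of w x] X that by simp
    then show ?thesis
      using w wF that by simp
  qed
  then show thesis
    using that F by blast
qed

end

section \<open>Weak-star null sequences\<close>

lemma infinite_eventually_along:
  assumes "infinite A" "\<forall>\<^sub>F n in along A. P n"
  shows "infinite {n\<in>A. P n}"
proof -
  obtain m where m: "\<And>n. n \<ge> m \<Longrightarrow> n \<in> A \<Longrightarrow> P n"
    using assms(2) by (auto simp: eventually_inf_principal eventually_sequentially)
  have "infinite (A - {..<m})"
    using assms(1) by simp
  moreover have "A - {..<m} \<subseteq> {n\<in>A. P n}"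
    using m by auto
  ultimately show ?thesis
    using finite_subset by blast
qed

lemma along_mono: "A \<subseteq> B \<Longrightarrow> along A \<le> along B"
  by (intro inf_mono order_refl) simp

lemma eventually_along_notin:
  assumes "finite B"
  shows "\<forall>\<^sub>F n in along A. n \<notin> B"
proof -
  obtain m where "\<And>n. n \<in> B \<Longrightarrow> n < m"
    using assms by (auto simp: finite_nat_set_iff_bounded)
  then show ?thesis
    by (auto simp: eventually_inf_principal eventually_sequentially intro!: exI[of _ m] dest: leD)
qed

context banach_over
begin

lemma subspace_dual: "dual_space.subspace (dual smul)"
  using subspace_annihilator[of "{}"] by (simp add: annihilator_def)

text \<open>Each evaluation at a point of \<open>X\<close> lowers the dimension of \<open>W\<close>
  by at most one, and after all of them nothing is left.\<close>

lemma subset_span_if_separated: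
  fixes W :: "('a \<Rightarrow>\<^sub>L 'k) set"
  assumes "finite X" and "dual_space.subspace W"
    and "\<And>w. w \<in> W \<Longrightarrow> (\<And>x. x \<in> X \<Longrightarrow> blinfun_apply w x = 0) \<Longrightarrow> w = 0"
  shows "\<exists>B. finite B \<and> card B \<le> card X \<and> W \<subseteq> dual_space.span B"
  using assms
proof (induction X arbitrary: W)
  case empty
  then show ?case
    by (intro exI[of _ "{}"]) auto
next
  case (insert x X)
  let ?W = "{w\<in>W. blinfun_apply w x = 0}"
  have "dual_space.subspace ?W"
    using insert.prems(1)
    by (auto simp: dual_space.subspace_def plus_blinfun.rep_eq dual_scale_apply)
  then have "\<exists>B. finite B \<and> card B \<le> card X \<and> ?W \<subseteq> dual_space.span B"
    using insert.prems(2) by (intro insert.IH) auto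
  then obtain B where B: "finite B" "card B \<le> card X" "?W \<subseteq> dual_space.span B"
    by (elim exE conjE)
  show ?case
  proof (cases "W \<subseteq> ?W")
    case True
    then show ?thesis
      using B insert.hyps by (intro exI[of _ B]) auto
  next
    case False
    then obtain w0 where w0: "w0 \<in> W" "blinfun_apply w0 x \<noteq> 0"
      by blast
    have "w \<in> dual_space.span (insert w0 B)" if "w \<in> W" for w
    proof -
      let ?c = "blinfun_apply w x / blinfun_apply w0 x"
      have "w - dual_scale ?c w0 \<in> ?W"
        using that w0 insert.prems(1)
        by (auto simp: minus_blinfun.rep_eq dual_scale_apply
            intro!: dual_space.subspace_diff dual_space.subspace_scale)
      then show ?thesis
        using B(3) dual_space.span_breakdown_eq by blast
    qed
    moreover have "card (insert w0 B) \<le> card (insert x X)"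
      using B insert.hyps by (simp add: card_insert_if)
    ultimately show ?thesis
      using B(1) by (intro exI[of _ "insert w0 B"]) auto
  qed
qed

lemma exists_unit_functional_vanishing:
  fixes F :: "('a \<Rightarrow>\<^sub>L 'k) set"
  assumes "finite F" "dual_space.independent F" "finite X" "card X < card F"
  obtains w where "w \<in> dual_space.span F" "norm w = 1" "\<And>x. x \<in> X \<Longrightarrow> blinfun_apply w x = 0"
proof -
  have "\<exists>w\<in>dual_space.span F. w \<noteq> 0 \<and> (\<forall>x\<in>X. blinfun_apply w x = 0)"
  proof (rule ccontr)
    assume "\<not> ?thesis"
    then obtain B where "finite B" "card B \<le> card X" "dual_space.span F \<subseteq> dual_space.span B"
      using subset_span_if_separated[OF assms(3) dual_space.subspace_span, of F] by auto
    then have "card F \<le> card X"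
      using dual_space.independent_span_bound[of B F] assms(2) dual_space.span_superset[of F]
      by (meson order_trans)
    then show False
      using assms(4) by simp
  qed
  then obtain w where w: "w \<in> dual_space.span F" "w \<noteq> 0" "\<And>x. x \<in> X \<Longrightarrow> blinfun_apply w x = 0"
    by blast
  show thesis
  proof
    show "w /\<^sub>R norm w \<in> dual_space.span F"
      using w(1) by (intro dual_space.scaleR_in_subspace) auto
    show "norm (w /\<^sub>R norm w) = 1"
      using w(2) by simp
    show "blinfun_apply (w /\<^sub>R norm w) x = 0" if "x \<in> X" for x
      using w(3)[OF that] by (simp add: scaleR_blinfun.rep_eq)
  qed
qed

text \<open>
  Zero lies in the weak-star closure of the union of the unit spheres of the spaces \<open>span (F n)\<close>,
  so some sequence from this union converges to zero. It visits each of these spheres only finitely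
  often, as they are norm compact.
\<close>

lemma exists_weak_star_null:
  fixes F :: "nat \<Rightarrow> ('a \<Rightarrow>\<^sub>L 'k) set"
  assumes BFU: "BFU_space smul"
    and F: "\<And>n. n \<in> A \<Longrightarrow> finite (F n) \<and> F n \<subseteq> dual smul \<and> dual_space.independent (F n)"
    and unb: "\<And>m. \<exists>n\<in>A. m < card (F n)"
  obtains J f where "J \<subseteq> A" "infinite J"
    "\<And>n. n \<in> J \<Longrightarrow> f n \<in> dual_space.span (F n) \<and> norm (f n) = 1"
    "\<And>x. ((\<lambda>n. blinfun_apply (f n) x) \<longlongrightarrow> 0) (along J)"
proof -
  define B where "B = {f \<in> dual smul. norm f \<le> 1}"
  define T where "T = subtopology (weak_star_topology smul) B"
  define G where "G = (\<Union>n\<in>A. {w \<in> dual_space.span (F n). norm w = 1})"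
  have T_eq: "T = subtopology strong_operator_topology B"
    by (auto simp: T_def weak_star_topology_def subtopology_subtopology B_def intro!: arg_cong2[where f = subtopology])
  have topT: "topspace T = B"
    by (simp add: T_eq strong_operator_topology_topspace)
  have span_dual: "dual_space.span (F n) \<subseteq> dual smul" if "n \<in> A" for n
    using F[OF that] subspace_dual by (intro dual_space.span_minimal) auto
  have "B \<subseteq> dual smul \<and> bounded B"
    by (auto simp: B_def bounded_iff)
  then have FU: "Frechet_Urysohn_space T"
    using BFU by (simp add: BFU_space_def T_def)
  have G: "G \<subseteq> topspace T"
    unfolding topT using span_dual by (auto simp: G_def B_def)
  have "0 \<in> T closure_of G"
    unfolding in_closure_of
  proof (intro conjI allI impI, goal_cases)
    case 1
    show ?case
      using subspace_dual dual_space.subspace_0 by (simp add: topT B_def)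
  next
    case (2 U)
    then obtain V where V: "openin strong_operator_topology V" "U = V \<inter> B"
      by (auto simp: T_eq openin_subtopology)
    then obtain O' where O': "open O'" "V = blinfun_apply -` O'"
      by (auto simp: strong_operator_topology_def openin_pullback_topology)
    have "blinfun_apply 0 \<in> O'"
      using 2 V O' by auto
    \<comment> \<open>A basic neighbourhood of zero restricts the values at finitely many points
      only; a space \<open>span (F n)\<close> of larger dimension contains a unit functional
      vanishing at all of them.\<close>
    then obtain Y where Y: "blinfun_apply 0 \<in> (\<Pi>\<^sub>E i\<in>UNIV. Y i)" "finite {i. Y i \<noteq> UNIV}"
        "(\<Pi>\<^sub>E i\<in>UNIV. Y i) \<subseteq> O'"
      using product_topology_open_contains_basis[OF O'(1)[unfolded open_fun_def], of "blinfun_apply 0"]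
      by (auto simp del: zero_blinfun.rep_eq)
    obtain n where n: "n \<in> A" "card {i. Y i \<noteq> UNIV} < card (F n)"
      using unb by blast
    obtain w where w: "w \<in> dual_space.span (F n)" "norm w = 1"
        "\<And>x. x \<in> {i. Y i \<noteq> UNIV} \<Longrightarrow> blinfun_apply w x = 0"
      using exists_unit_functional_vanishing[of "F n" "{i. Y i \<noteq> UNIV}"] F[OF n(1)] Y(2) n(2) by metis
    have "blinfun_apply w i \<in> Y i" for i
      using w(3)[of i] Y(1) by (cases "Y i = UNIV") (auto simp: PiE_iff)
    then have "w \<in> V"
      using Y(3) O'(2) by auto
    moreover have "w \<in> G"
      using w n(1) by (auto simp: G_def)
    moreover have "w \<in> B"
      using w span_dual[OF n(1)] by (auto simp: B_def)
    ultimately show ?case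
      using V(2) by blast
  qed
  then obtain s where s: "range s \<subseteq> G" "limitin T s 0 sequentially"
    using FU G unfolding Frechet_Urysohn_space_def by blast
  have null: "(\<lambda>i. blinfun_apply (s i) x) \<longlonglongrightarrow> 0" for x
  proof -
    have "continuous_map T euclidean (\<lambda>f. blinfun_apply f x)"
      unfolding T_eq by (intro continuous_map_from_subtopology strong_operator_topology_continuous_evaluation)
    from continuous_map_limit[OF this s(2)] show ?thesis
      by (simp add: o_def)
  qed
  have "\<exists>n. n \<in> A \<and> s i \<in> dual_space.span (F n) \<and> norm (s i) = 1" for i
    using s(1) by (auto simp: G_def)
  then obtain k where k: "\<And>i. k i \<in> A" "\<And>i. s i \<in> dual_space.span (F (k i))" "\<And>i. norm (s i) = 1"
    by metis
  \<comment> \<open>Infinitely many visits to one sphere would have a norm limit point of norm 1,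
    while pointwise convergence makes it zero.\<close>
  have fin: "finite {i. k i = n}" for n
  proof (rule ccontr)
    assume inf: "infinite {i. k i = n}"
    define r where "r = enumerate {i. k i = n}"
    have r: "strict_mono r" "\<And>j. k (r j) = n"
      using inf enumerate_in_set[OF inf] by (auto simp: r_def strict_mono_enumerate)
    then have n: "n \<in> A"
      using k(1) by metis
    have "\<exists>l q. strict_mono (q :: nat \<Rightarrow> nat) \<and> ((s \<circ> r) \<circ> q) \<longlonglongrightarrow> l"
    proof (rule dual_space.span_finite_seq_compact)
      show "finite (F n)"
        using F[OF n] by simp
      show "(s \<circ> r) j \<in> dual_space.span (F n)" for j
        using k(2)[of "r j"] r(2)[of j] by simp
      show "bounded (range (s \<circ> r))"
        by (auto simp: bounded_iff k(3))
    qed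
    then obtain l q where q: "strict_mono (q :: nat \<Rightarrow> nat)" "((s \<circ> r) \<circ> q) \<longlonglongrightarrow> l"
      by blast
    have "(\<lambda>j. norm (((s \<circ> r) \<circ> q) j)) \<longlonglongrightarrow> norm l"
      using q(2) by (rule tendsto_norm)
    then have "norm l = 1"
      by (simp add: k(3) LIMSEQ_const_iff)
    have "blinfun_apply l x = 0" for x
    proof (rule LIMSEQ_unique)
      show "(\<lambda>j. blinfun_apply (((s \<circ> r) \<circ> q) j) x) \<longlonglongrightarrow> blinfun_apply l x"
        by (intro blinfun.tendsto q(2) tendsto_const)
      show "(\<lambda>j. blinfun_apply (((s \<circ> r) \<circ> q) j) x) \<longlonglongrightarrow> 0"
        using LIMSEQ_subseq_LIMSEQ[OF null[of x] strict_mono_o[OF r(1) q(1)]] by (simp add: o_def)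
    qed
    then have "l = 0"
      by (intro blinfun_eqI) simp
    then show False
      using \<open>norm l = 1\<close> by simp
  qed
  define J where "J = range k"
  \<comment> \<open>For each visited index \<open>n\<close>, \<open>i n\<close> is one time of a
    visit. The first \<open>m\<close> times meet finitely many indices, so
    \<open>i n \<ge> m\<close> eventually along \<open>J\<close> and the limit carries over.\<close>
  define i where "i = inv_into UNIV k"
  have ki: "k (i n) = n" if "n \<in> J" for n
    using that by (simp add: J_def i_def f_inv_into_f)
  show thesis
  proof
    show "J \<subseteq> A"
      using k(1) by (auto simp: J_def)
    show "infinite J"
    proof
      assume "finite J"
      then have "finite (\<Union>n\<in>J. {i. k i = n})"
        using fin by blast
      moreover have "(\<Union>n\<in>J. {i. k i = n}) = UNIV"
        by (auto simp: J_def)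
      ultimately show False
        by simp
    qed
    show "s (i n) \<in> dual_space.span (F n) \<and> norm (s (i n)) = 1" if "n \<in> J" for n
      using k(2)[of "i n"] k(3) ki[OF that] by simp
    show "((\<lambda>n. blinfun_apply (s (i n)) x) \<longlongrightarrow> 0) (along J)" for x
    proof (rule tendstoI)
      fix e :: real assume "e > 0"
      then obtain m where m: "\<And>j. j \<ge> m \<Longrightarrow> dist (blinfun_apply (s j) x) 0 < e"
        using metric_LIMSEQ_D[OF null] by blast
      have "\<forall>\<^sub>F n in along J. n \<notin> k ` {..<m}"
        by (intro eventually_along_notin) simp
      moreover have "\<forall>\<^sub>F n in along J. n \<in> J"
        by (simp add: eventually_inf_principal)
      ultimately show "\<forall>\<^sub>F n in along J. dist (blinfun_apply (s (i n)) x) 0 < e"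
      proof eventually_elim
        case (elim n)
        then have "\<not> i n < m"
          using ki by (metis imageI lessThan_iff)
        then show ?case
          using m[of "i n"] by simp
      qed
    qed
  qed
qed

end

section \<open>Adjustment constants and decomposition constants\<close>

text \<open>The choice \<open>y = 0\<close>, \<open>z = 0\<close> leaves the unit vectors
  themselves, so the infimum in \<open>adj_lambda\<close> is over a nonempty set.\<close>

lemma unif_adjusted_1:
  assumes "\<And>n. n \<in> A \<Longrightarrow> 0 \<in> P n"
  shows "unif_adjusted A M P 1"
  unfolding unif_adjusted_def
proof (intro allI impI, elim conjE)
  fix \<eta> :: real and A2 x
  assume *: "\<eta> > 0" "A2 \<subseteq> A" "infinite A2" "\<forall>n\<in>A2. x n \<in> M n \<and> norm (x n) = 1"
  have "Limsup (along A2) (\<lambda>n. ereal (norm (x n - 0 - 0))) \<le> ereal (1 + \<eta>)"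
    by (rule Limsup_bounded) (use * in \<open>simp add: eventually_inf_principal\<close>)
  then show "\<exists>A3 y z. A3 \<subseteq> A2 \<and> infinite A3 \<and> (\<forall>n\<in>A3. y n \<in> P n) \<and>
      Limsup (along A3) (\<lambda>n. ereal (norm (x n - y n - z))) \<le> ereal (1 + \<eta>)"
    using * assms by (intro exI[of _ A2] exI[of _ "\<lambda>_. 0"] exI[of _ 0] conjI) auto
qed

lemma adj_lambda_nonneg:
  assumes "\<And>n. n \<in> A \<Longrightarrow> 0 \<in> P n"
  shows "adj_lambda A M P \<ge> 0"
  unfolding adj_lambda_def
proof (rule cInf_greatest)
  show "{l. l \<ge> 0 \<and> unif_adjusted A M P l} \<noteq> {}"
    using unif_adjusted_1[of A P M] assms by (auto intro!: exI[of _ 1])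
qed simp

lemma adj_lambda_approx:
  assumes "\<And>n. n \<in> A \<Longrightarrow> 0 \<in> P n" "e > 0"
  obtains l where "l < adj_lambda A M P + e" "unif_adjusted A M P l"
proof -
  have "{l. l \<ge> 0 \<and> unif_adjusted A M P l} \<noteq> {}"
    using unif_adjusted_1[of A P M] assms by (auto intro!: exI[of _ 1])
  then obtain l where "l \<in> {l. l \<ge> 0 \<and> unif_adjusted A M P l}" "l < adj_lambda A M P + e"
    using cInf_lessD[of _ "adj_lambda A M P + e"] assms(2) unfolding adj_lambda_def
    by (metis less_add_same_cancel1)
  then show thesis
    using that by blast
qed

text \<open>Up to the adjustment error, \<open>u n\<close> is \<open>y n + z\<close> with
  \<open>y n \<in> P n\<close>. The functional is small on the bounded vectors \<open>y n\<close>
  and tends to zero at the fixed \<open>z\<close>, so only the error contributes in the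
  limit.\<close>

lemma adjusted_evaluation_le:
  fixes f :: "nat \<Rightarrow> 'a::real_normed_vector \<Rightarrow>\<^sub>L 'k::real_normed_vector"
  assumes P: "\<And>n. n \<in> A \<Longrightarrow> 0 \<in> P n" and J: "J \<subseteq> A" "infinite J"
    and u: "\<And>n. n \<in> J \<Longrightarrow> u n \<in> M n \<and> norm (u n) = 1"
    and f: "\<And>n. n \<in> J \<Longrightarrow> norm (f n) \<le> 1"
    and null: "\<And>x. ((\<lambda>n. blinfun_apply (f n) x) \<longlongrightarrow> 0) (along J)"
    and small: "\<And>n y. n \<in> J \<Longrightarrow> y \<in> P n \<Longrightarrow> norm (blinfun_apply (f n) y) \<le> r n * norm y"
    and r: "(r \<longlongrightarrow> 0) (along J)" and e: "e > 0"
  shows "\<exists>J'\<subseteq>J. infinite J' \<and>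
    (\<forall>n\<in>J'. norm (blinfun_apply (f n) (u n)) \<le> adj_lambda A M P + e)"
proof -
  \<comment> \<open>One share is for choosing \<open>l\<close>, two for the upper limit, and one
    each for the values at \<open>y n\<close> and \<open>z\<close>.\<close>
  define \<eta> where "\<eta> = e / 5"
  have \<eta>: "\<eta> > 0"
    using e by (simp add: \<eta>_def)
  obtain l where l: "l < adj_lambda A M P + \<eta>" "unif_adjusted A M P l"
    by (rule adj_lambda_approx[of A P \<eta> M]) (use P \<eta> in auto)
  have "J \<subseteq> A \<and> infinite J \<and> (\<forall>n\<in>J. u n \<in> M n \<and> norm (u n) = 1)"
    using J u by simp
  with l(2) \<eta> have "\<exists>A3 y z. A3 \<subseteq> J \<and> infinite A3 \<and> (\<forall>n\<in>A3. y n \<in> P n) \<and>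
      Limsup (along A3) (\<lambda>n. ereal (norm (u n - y n - z))) \<le> ereal (l + \<eta>)"
    unfolding unif_adjusted_def by presburger
  then obtain J3 y z
    where J3: "J3 \<subseteq> J" "infinite J3" "\<forall>n\<in>J3. y n \<in> P n"
      and "Limsup (along J3) (\<lambda>n. ereal (norm (u n - y n - z))) \<le> ereal (l + \<eta>)"
    by (elim exE conjE)
  then have "Limsup (along J3) (\<lambda>n. ereal (norm (u n - y n - z))) < ereal (l + 2 * \<eta>)"
    using \<eta> by (elim order_le_less_trans) simp
  then have ev1: "\<forall>\<^sub>F n in along J3. norm (u n - y n - z) < l + 2 * \<eta>"
    by (auto dest!: Limsup_lessD)
  \<comment> \<open>This bounds \<open>norm (y n)\<close>, as \<open>y n\<close> is the unit vector
    \<open>u n\<close> minus \<open>z\<close> and minus the error.\<close>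
  define R where "R = 1 + norm z + (l + 2 * \<eta>)"
  have "((\<lambda>n. norm (blinfun_apply (f n) z)) \<longlongrightarrow> 0) (along J3)"
    using tendsto_norm_zero[OF tendsto_mono[OF along_mono[OF J3(1)] null]] .
  then have ev2: "\<forall>\<^sub>F n in along J3. norm (blinfun_apply (f n) z) < \<eta>"
    using \<eta> by (rule order_tendstoD)
  have "((\<lambda>n. norm (r n) * R) \<longlongrightarrow> 0) (along J3)"
    using tendsto_mult_left_zero[OF tendsto_norm_zero[OF tendsto_mono[OF along_mono[OF J3(1)] r]]] .
  then have ev3: "\<forall>\<^sub>F n in along J3. norm (r n) * R < \<eta>"
    using \<eta> by (rule order_tendstoD)
  define J' where "J' = {n\<in>J3. norm (u n - y n - z) < l + 2 * \<eta> \<and>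
      norm (blinfun_apply (f n) z) < \<eta> \<and> norm (r n) * R < \<eta>}"
  show ?thesis
  proof (intro exI[of _ J'] conjI ballI)
    show "J' \<subseteq> J"
      using J3 by (auto simp: J'_def)
    show "infinite J'"
      unfolding J'_def using J3(2) eventually_conj[OF ev1 eventually_conj[OF ev2 ev3]]
      by (rule infinite_eventually_along)
    fix n assume n: "n \<in> J'"
    then have nJ: "n \<in> J" and yP: "y n \<in> P n" and n1: "norm (u n - y n - z) < l + 2 * \<eta>"
      and n2: "norm (blinfun_apply (f n) z) < \<eta>" and n3: "norm (r n) * R < \<eta>"
      using J3 by (auto simp: J'_def)
    have "y n = u n - z - (u n - y n - z)"
      by simp
    then have "norm (y n) \<le> norm (u n - z) + norm (u n - y n - z)"
      by (metis norm_triangle_ineq4)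
    then have "norm (y n) \<le> R"
      using n1 norm_triangle_ineq4[of "u n" z] u[OF nJ] by (simp add: R_def)
    then have "norm (r n) * norm (y n) \<le> norm (r n) * R"
      by (intro mult_left_mono) auto
    moreover have "r n * norm (y n) \<le> norm (r n) * norm (y n)"
      by (intro mult_right_mono) auto
    ultimately have fy: "norm (blinfun_apply (f n) (y n)) \<le> \<eta>"
      using small[OF nJ yP] n3 by linarith
    have "norm (blinfun_apply (f n) (u n - y n - z)) \<le> norm (f n) * norm (u n - y n - z)"
      by (rule norm_blinfun)
    also have "\<dots> \<le> 1 * norm (u n - y n - z)"
      using f[OF nJ] by (intro mult_right_mono) auto
    finally have fd: "norm (blinfun_apply (f n) (u n - y n - z)) \<le> l + 2 * \<eta>"
      using n1 by simp
    have "blinfun_apply (f n) (u n) =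
        blinfun_apply (f n) (u n - y n - z) + blinfun_apply (f n) (y n) + blinfun_apply (f n) z"
      by (simp add: blinfun.diff_right)
    also have "norm \<dots> \<le> (l + 2 * \<eta>) + \<eta> + \<eta>"
      using n2 by (intro norm_triangle_mono fd fy) simp
    finally have "norm (blinfun_apply (f n) (u n)) \<le> (l + 2 * \<eta>) + \<eta> + \<eta>" .
    then show "norm (blinfun_apply (f n) (u n)) \<le> adj_lambda A M P + e"
      using l(1) by (simp add: \<eta>_def)
  qed
qed

context banach_over
begin

text \<open>The strict inequality survives when the infimum is replaced by a nearby admissible
  constant; for \<open>L = 0\<close> every admissible constant will do.\<close>

lemma psi_compl_approx:
  assumes cl: "closed_subspace smul M" "closed_subspace smul N" "closed_subspace smul S"
    and sum: "M + N + S = UNIV" and L: "L \<ge> 0" "psi_compl S M N * L < 1"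
  obtains \<gamma> where "\<gamma> > 0" "\<gamma> * L < 1" "\<And>x. \<exists>a\<in>M. \<exists>b\<in>N. \<exists>c\<in>S. x = a + b + c \<and>
      norm a \<le> \<gamma> * norm x \<and> norm b \<le> \<gamma> * norm x \<and> norm c \<le> \<gamma> * norm x"
proof -
  define R where "R = {\<gamma>. \<gamma> > 0 \<and> (\<forall>x. \<exists>a\<in>M. \<exists>b\<in>N. \<exists>c\<in>S. x = a + b + c \<and>
      max (norm a) (max (norm b) (norm c)) \<le> \<gamma> * norm x)}"
  have R: "R \<noteq> {}"
    using bounded_decomposition[OF cl sum] unfolding R_def by blast
  have "\<exists>\<gamma>\<in>R. \<gamma> * L < 1"
  proof (cases "L = 0")
    case True
    then show ?thesis
      using R by auto
  next
    case False
    then have "Inf R < 1 / L"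
      using L by (simp add: psi_compl_def R_def pos_less_divide_eq)
    then obtain \<gamma> where "\<gamma> \<in> R" "\<gamma> < 1 / L"
      using cInf_lessD[OF R] by blast
    then show ?thesis
      using L False by (intro bexI[of _ \<gamma>]) (auto simp: pos_less_divide_eq)
  qed
  then show thesis
    using that by (auto simp: R_def)
qed

end

section \<open>Perturbation of upper semi-Fredholm pairs\<close>

lemma blinfun_unit_vector:
  fixes f :: "'a::real_normed_vector \<Rightarrow>\<^sub>L 'b::real_normed_vector"
  assumes "norm f = 1" "0 < e" "e < 1"
  obtains x where "norm x = 1" "1 - e < norm (blinfun_apply f x)"
proof -
  have "\<exists>x. norm x = 1 \<and> 1 - e < norm (blinfun_apply f x)"
  proof (rule ccontr)
    assume *: "\<not> ?thesis"
    have "norm (blinfun_apply f x) \<le> (1 - e) * norm x" for x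
    proof (cases "x = 0")
      case False
      then have "norm (blinfun_apply f (x /\<^sub>R norm x)) \<le> 1 - e"
        using * by (simp add: not_less)
      then show ?thesis
        using False by (simp add: blinfun.scaleR_right field_simps)
    qed simp
    then have "norm f \<le> 1 - e"
      using assms by (intro norm_blinfun_bound) auto
    then show False
      using assms by simp
  qed
  then show thesis
    using that by blast
qed

context banach_over
begin

text \<open>The adjustment condition speaks of unit vectors, so components are written as multiples
  of such. A zero component takes an arbitrary unit vector, available since \<open>M\<close> is
  non-null.\<close>

lemma unit_direction:
  assumes "subspace M" "M \<noteq> {0}" "a \<in> M"
  obtains u where "u \<in> M" "norm u = 1" "a = norm a *\<^sub>R u"
proof -
  obtain v where v: "v \<in> M" "v \<noteq> 0"
    using assms(1,2) subspace_0 by blast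
  define u where "u = (if a = 0 then v /\<^sub>R norm v else a /\<^sub>R norm a)"
  show thesis
  proof
    show "u \<in> M"
      using assms v by (auto simp: u_def scaleR_in_subspace)
    show "norm u = 1" "a = norm a *\<^sub>R u"
      using v by (auto simp: u_def)
  qed
qed

text \<open>Subtracting from \<open>w\<close> a functional that annihilates \<open>N\<close> does
  not change its value at \<open>b\<close>; the infimum over such functionals gives the
  bound.\<close>

lemma infdist_annihilator:
  assumes w: "w \<in> dual smul" and b: "b \<in> N"
  shows "norm (blinfun_apply w b) \<le> infdist w (annihilator smul N) * norm b"
proof (cases "b = 0")
  case False
  have ne: "annihilator smul N \<noteq> {}"
    using subspace_annihilator dual_space.subspace_0 by blast
  have "norm (blinfun_apply w b) / norm b \<le> dist w g" if "g \<in> annihilator smul N" for g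
  proof -
    have "blinfun_apply w b = blinfun_apply (w - g) b"
      using that b by (simp add: annihilator_def minus_blinfun.rep_eq)
    then show ?thesis
      using norm_blinfun[of "w - g" b] False by (simp add: dist_norm pos_divide_le_eq)
  qed
  then have "norm (blinfun_apply w b) / norm b \<le> infdist w (annihilator smul N)"
    unfolding infdist_notempty[OF ne] using ne by (intro cINF_greatest)
  then show ?thesis
    using False by (simp add: pos_divide_le_eq)
qed simp

lemma gap_annihilator:
  assumes W: "dual_space.subspace W" "W \<subseteq> dual smul" and w: "w \<in> W" and b: "b \<in> N"
  shows "norm (blinfun_apply w b) \<le> gap W (annihilator smul N) * norm w * norm b"
proof (cases "w = 0")
  case False
  have "0 \<in> annihilator smul N"
    using subspace_annihilator dual_space.subspace_0 by blast
  then have "infdist v (annihilator smul N) \<le> norm v" for v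
    using infdist_le[of 0 "annihilator smul N" v] by (simp add: dist_norm)
  \<comment> \<open>Since zero annihilates \<open>N\<close>, distances from unit functionals are at
    most 1, and the supremum defining the gap is a genuine one.\<close>
  then have bdd: "bdd_above ((\<lambda>v. infdist v (annihilator smul N)) ` {v \<in> W. norm v = 1})"
    by (intro bdd_aboveI[of _ 1]) (metis (mono_tags, lifting) imageE mem_Collect_eq)
  define v where "v = w /\<^sub>R norm w"
  have v: "v \<in> W" "norm v = 1"
    using False w W(1) by (simp_all add: v_def dual_space.scaleR_in_subspace)
  have "norm (blinfun_apply v b) \<le> infdist v (annihilator smul N) * norm b"
    using v W b by (intro infdist_annihilator) auto
  also have "\<dots> \<le> gap W (annihilator smul N) * norm b"
    unfolding gap_def using v by (intro mult_right_mono cSUP_upper bdd) auto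
  finally show ?thesis
    using False by (simp add: v_def scaleR_blinfun.rep_eq field_simps)
qed simp

text \<open>Common core of both claims. Finite independent sets \<open>F n\<close> stand for
  subspaces, so that dimension is a cardinality; \<open>r\<close> is the gap in the second claim and
  an explicit null sequence in the first.\<close>

lemma card_almost_annihilating_bounded:
  assumes BFU: "BFU_space smul"
    and cl: "closed_subspace smul M" "closed_subspace smul N" "closed_subspace smul S"
    and ne: "M \<noteq> {0}" "N \<noteq> {0}" and sum: "M + N + S = UNIV"
    and S: "finite C" "S \<subseteq> span C"
    and 0: "\<And>n. n \<in> A \<Longrightarrow> 0 \<in> Mn n \<and> 0 \<in> Nn n"
    and small: "psi_compl S M N * (adj_lambda A (\<lambda>_. M) Mn + adj_lambda A (\<lambda>_. N) Nn) < 1"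
    and "A' \<subseteq> A"
    and F: "\<And>n. n \<in> A' \<Longrightarrow>
      finite (F n) \<and> F n \<subseteq> annihilator smul (Mn n) \<and> dual_space.independent (F n)"
    and almost: "\<And>n w b. n \<in> A' \<Longrightarrow> w \<in> dual_space.span (F n) \<Longrightarrow> b \<in> Nn n \<Longrightarrow>
      norm (blinfun_apply w b) \<le> r n * norm w * norm b"
    and r: "(r \<longlongrightarrow> 0) (along A')"
  shows "\<exists>m. \<forall>n\<in>A'. card (F n) \<le> m"
proof (rule ccontr)
  assume "\<not> ?thesis"
  then have unb: "\<exists>n\<in>A'. m < card (F n)" for m
    by (meson not_le)
  define L where "L = adj_lambda A (\<lambda>_. M) Mn + adj_lambda A (\<lambda>_. N) Nn"
  have L: "L \<ge> 0"
    unfolding L_def using 0 by (intro add_nonneg_nonneg adj_lambda_nonneg) auto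
  obtain \<gamma> where \<gamma>: "\<gamma> > 0" "\<gamma> * L < 1"
    and dec: "\<And>x. \<exists>a\<in>M. \<exists>b\<in>N. \<exists>c\<in>S. x = a + b + c \<and>
        norm a \<le> \<gamma> * norm x \<and> norm b \<le> \<gamma> * norm x \<and> norm c \<le> \<gamma> * norm x"
    using psi_compl_approx[OF cl sum L small[folded L_def]] by metis
  \<comment> \<open>The errors are \<open>\<gamma> * e\<close> for each of the \<open>M\<close>- and
    \<open>N\<close>-components, \<open>2 * e\<close> for the \<open>S\<close>-component and
    \<open>e\<close> for the norming vector. The total \<open>(2 * \<gamma> + 3) * e\<close> stays
    strictly below \<open>1 - \<gamma> * L\<close>.\<close>
  define e where "e = (1 - \<gamma> * L) / (2 * \<gamma> + 4)"
  have e: "e > 0"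
    using \<gamma> by (simp add: e_def)
  have e_eq: "(2 * \<gamma> + 4) * e = 1 - \<gamma> * L"
    using \<gamma> by (simp add: e_def)
  have "\<gamma> * e > 0" "\<gamma> * L \<ge> 0"
    using e \<gamma> L by simp_all
  then have e1: "e < 1" and contra: "\<gamma> * L + 2 * (\<gamma> * e) + 3 * e < 1"
    using e e_eq by (simp_all add: algebra_simps)
  have F': "finite (F n) \<and> F n \<subseteq> dual smul \<and> dual_space.independent (F n)" if "n \<in> A'" for n
    using F[OF that] by (auto simp: annihilator_def)
  obtain J f where J: "J \<subseteq> A'" "infinite J"
      and f: "\<And>n. n \<in> J \<Longrightarrow> f n \<in> dual_space.span (F n) \<and> norm (f n) = 1"
      and null: "\<And>x. ((\<lambda>n. blinfun_apply (f n) x) \<longlongrightarrow> 0) (along J)"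
    using exists_weak_star_null[OF BFU, of A' F] F' unb by blast
  have "\<exists>u v c t s. u \<in> M \<and> norm u = 1 \<and> v \<in> N \<and> norm v = 1 \<and> c \<in> S \<and> norm c \<le> \<gamma> \<and>
      0 \<le> t \<and> t \<le> \<gamma> \<and> 0 \<le> s \<and> s \<le> \<gamma> \<and> 1 - e < norm (blinfun_apply (f n) (t *\<^sub>R u + s *\<^sub>R v + c))"
    if n: "n \<in> J" for n
  proof -
    obtain x where x: "norm x = 1" "1 - e < norm (blinfun_apply (f n) x)"
      using blinfun_unit_vector[of "f n" e] f[OF n] e e1 by metis
    obtain a b c where abc: "a \<in> M" "b \<in> N" "c \<in> S" "x = a + b + c"
        "norm a \<le> \<gamma>" "norm b \<le> \<gamma>" "norm c \<le> \<gamma>"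
      using dec[of x] x(1) by auto
    obtain u where u: "u \<in> M" "norm u = 1" "a = norm a *\<^sub>R u"
      using unit_direction[OF _ ne(1) abc(1)] cl(1) by (auto simp: closed_subspace_def)
    obtain v where v: "v \<in> N" "norm v = 1" "b = norm b *\<^sub>R v"
      using unit_direction[OF _ ne(2) abc(2)] cl(2) by (auto simp: closed_subspace_def)
    show ?thesis
      using u v abc x(2)
      by (intro exI[of _ u] exI[of _ v] exI[of _ c] exI[of _ "norm a"] exI[of _ "norm b"]) auto
  qed
  then obtain u v c t s where uv:
    "\<And>n. n \<in> J \<Longrightarrow> u n \<in> M \<and> norm (u n) = 1" "\<And>n. n \<in> J \<Longrightarrow> v n \<in> N \<and> norm (v n) = 1"
    and c: "\<And>n. n \<in> J \<Longrightarrow> c n \<in> S \<and> norm (c n) \<le> \<gamma>"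
    and ts: "\<And>n. n \<in> J \<Longrightarrow> 0 \<le> t n \<and> t n \<le> \<gamma> \<and> 0 \<le> s n \<and> s n \<le> \<gamma>"
    and big: "\<And>n. n \<in> J \<Longrightarrow> 1 - e < norm (blinfun_apply (f n) (t n *\<^sub>R u n + s n *\<^sub>R v n + c n))"
    by metis
  have J_A: "J \<subseteq> A"
    using J \<open>A' \<subseteq> A\<close> by blast
  have f_ann: "blinfun_apply (f n) y = 0" if "n \<in> J" "y \<in> Mn n" for n y
  proof -
    have "n \<in> A'"
      using that J by blast
    then have "dual_space.span (F n) \<subseteq> annihilator smul (Mn n)"
      using F by (intro dual_space.span_minimal subspace_annihilator) auto
    then show ?thesis
      using f[OF that(1)] that(2) by (auto simp: annihilator_def)
  qed
  have f1: "norm (f n) \<le> 1" if "n \<in> J" for n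
    using f[OF that] by simp
  have 0: "0 \<in> Mn n" "0 \<in> Nn n" if "n \<in> A" for n
    using 0 that by auto
  have small1: "norm (blinfun_apply (f n) y) \<le> 0 * norm y" if "n \<in> J" "y \<in> Mn n" for n y
    using f_ann that by simp
  \<comment> \<open>On \<open>Mn n\<close> the functionals vanish exactly, so the tolerance is zero
    here. The same lemma is applied to \<open>v\<close> within the resulting \<open>J1\<close>, so
    that both bounds hold on \<open>J2\<close>.\<close>
  have "\<exists>J'\<subseteq>J. infinite J' \<and>
      (\<forall>n\<in>J'. norm (blinfun_apply (f n) (u n)) \<le> adj_lambda A (\<lambda>_. M) Mn + e)"
    by (rule adjusted_evaluation_le[where u = u and f = f and r = "\<lambda>_. 0"])
      (fact 0 J_A J uv f1 null small1 tendsto_const e)+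
  then obtain J1 where J1: "J1 \<subseteq> J" "infinite J1"
      "\<forall>n\<in>J1. norm (blinfun_apply (f n) (u n)) \<le> adj_lambda A (\<lambda>_. M) Mn + e"
    by (elim exE conjE)
  have J1A: "J1 \<subseteq> A'" "J1 \<subseteq> A"
    using J1 J J_A by blast+
  have v1: "v n \<in> N \<and> norm (v n) = 1" and f2: "norm (f n) \<le> 1" if "n \<in> J1" for n
    using uv(2) f1 that J1(1) by auto
  have small2: "norm (blinfun_apply (f n) y) \<le> r n * norm y" if "n \<in> J1" "y \<in> Nn n" for n y
  proof -
    have "n \<in> A'" "n \<in> J"
      using that J1A(1) J1(1) by auto
    then show ?thesis
      using almost[of n "f n" y] f[of n] that(2) by simp
  qed
  have null1: "((\<lambda>n. blinfun_apply (f n) x) \<longlongrightarrow> 0) (along J1)" for x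
    by (rule tendsto_mono[OF along_mono[OF J1(1)] null])
  have r1: "(r \<longlongrightarrow> 0) (along J1)"
    by (rule tendsto_mono[OF along_mono[OF J1A(1)] r])
  have "\<exists>J'\<subseteq>J1. infinite J' \<and>
      (\<forall>n\<in>J'. norm (blinfun_apply (f n) (v n)) \<le> adj_lambda A (\<lambda>_. N) Nn + e)"
    by (rule adjusted_evaluation_le[where u = v and f = f and r = r])
      (fact 0 J1A J1 v1 f2 null1 small2 r1 e)+
  then obtain J2 where J2: "J2 \<subseteq> J1" "infinite J2"
      "\<forall>n\<in>J2. norm (blinfun_apply (f n) (v n)) \<le> adj_lambda A (\<lambda>_. N) Nn + e"
    by (elim exE conjE)
  define j where "j = enumerate J2"
  have j: "strict_mono j" "\<And>i. j i \<in> J2"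
    using J2(2) by (auto simp: j_def strict_mono_enumerate enumerate_in_set)
  have jJ: "j i \<in> J" for i
    using j(2) J2(1) J1(1) by blast
  \<comment> \<open>Finite dimension of \<open>S\<close> replaces the varying \<open>c n\<close> by
    a fixed \<open>l\<close>, on which the weak-star null functionals become small.\<close>
  have "\<exists>l q. strict_mono (q :: nat \<Rightarrow> nat) \<and> ((c \<circ> j) \<circ> q) \<longlonglongrightarrow> l"
  proof (rule span_finite_seq_compact[OF S(1)])
    show "(c \<circ> j) i \<in> span C" for i
      using c[OF jJ] S(2) by auto
    show "bounded (range (c \<circ> j))"
      using c[OF jJ] by (auto simp: bounded_iff)
  qed
  then obtain l q where q: "strict_mono (q :: nat \<Rightarrow> nat)" "((c \<circ> j) \<circ> q) \<longlonglongrightarrow> l"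
    by blast
  define k where "k = j \<circ> q"
  have k: "strict_mono k" "\<And>i. k i \<in> J2" "\<And>i. k i \<in> J" "(\<lambda>i. c (k i)) \<longlonglongrightarrow> l"
    using strict_mono_o[OF j(1) q(1)] j(2) jJ q(2) by (auto simp: k_def o_def)
  have "\<forall>\<^sub>F i in sequentially. dist (c (k i)) l < e"
    using k(4) e by (rule tendstoD)
  moreover have "filterlim k (along J) sequentially"
    using filterlim_subseq[OF k(1)] k(3) by (simp add: filterlim_inf filterlim_principal)
  then have "(\<lambda>i. blinfun_apply (f (k i)) l) \<longlonglongrightarrow> 0"
    by (rule filterlim_compose[OF null])
  then have "\<forall>\<^sub>F i in sequentially. dist (blinfun_apply (f (k i)) l) 0 < e"
    using e by (rule tendstoD)
  ultimately have "\<forall>\<^sub>F i in sequentially. dist (c (k i)) l < e \<and> dist (blinfun_apply (f (k i)) l) 0 < e"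
    by (rule eventually_conj)
  then obtain i where i: "dist (c (k i)) l < e" "norm (blinfun_apply (f (k i)) l) < e"
    by (auto dest: eventually_happens)
  define n where "n = k i"
  have n: "n \<in> J" "n \<in> J1" "n \<in> J2"
    using k J2(1) by (auto simp: n_def)
  have fu: "norm (blinfun_apply (f n) (t n *\<^sub>R u n)) \<le> \<gamma> * (adj_lambda A (\<lambda>_. M) Mn + e)"
    using ts[OF n(1)] bspec[OF J1(3) n(2)] by (auto simp: blinfun.scaleR_right intro!: mult_mono)
  have fv: "norm (blinfun_apply (f n) (s n *\<^sub>R v n)) \<le> \<gamma> * (adj_lambda A (\<lambda>_. N) Nn + e)"
    using ts[OF n(1)] bspec[OF J2(3) n(3)] by (auto simp: blinfun.scaleR_right intro!: mult_mono)
  have "norm (blinfun_apply (f n) (c n - l)) \<le> norm (c n - l)"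
    using norm_blinfun[of "f n" "c n - l"] f[OF n(1)] by simp
  then have "norm (blinfun_apply (f n) (c n - l) + blinfun_apply (f n) l) \<le> e + e"
    using i by (intro norm_triangle_mono) (simp_all add: n_def dist_norm)
  then have fc: "norm (blinfun_apply (f n) (c n)) \<le> e + e"
    by (simp add: blinfun.diff_right)
  have "norm (blinfun_apply (f n) (t n *\<^sub>R u n + s n *\<^sub>R v n + c n))
      \<le> \<gamma> * (adj_lambda A (\<lambda>_. M) Mn + e) + \<gamma> * (adj_lambda A (\<lambda>_. N) Nn + e) + (e + e)"
    unfolding blinfun.add_right by (intro norm_triangle_mono fu fv fc)
  then show False
    using big[OF n(1)] contra by (simp add: L_def algebra_simps)
qed

text \<open>For infinite dimension the size \<open>n\<close> is free. It will be the index of the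
  sequence, so that a uniform bound on cardinalities excludes infinite dimension for large
  indices.\<close>

lemma exists_independent_subset_edim:
  fixes W :: "'a set"
  shows "\<exists>F. finite F \<and> F \<subseteq> W \<and> independent F \<and>
    (edim smul W = enat (card F) \<or> edim smul W = \<infinity> \<and> card F = n)"
proof -
  obtain B where B: "B \<subseteq> W" "independent B" "W \<subseteq> span B" "card B = dim W"
    using basis_exists by metis
  show ?thesis
  proof (cases "\<exists>D. finite D \<and> W \<subseteq> span D")
    case True
    then obtain D where D: "finite D" "W \<subseteq> span D"
      by blast
    then have "finite B"
      using independent_span_bound[OF D(1) B(2)] B(1) by (meson order_trans)
    moreover have "edim smul W = enat (card B)"
      using True B(4) by (simp add: edim_def)
    ultimately show ?thesis
      using B by blast
  next
    case False
    then have "infinite B"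
      using B(3) by blast
    then obtain F where F: "finite F" "F \<subseteq> B" "card F = n"
      using infinite_arbitrarily_large by metis
    have "independent F"
      using B(2) F(2) by (rule independent_mono)
    moreover have "edim smul W = \<infinity>"
      unfolding edim_def using False by (rule if_not_P)
    ultimately show ?thesis
      using B(1) F by (intro exI[of _ F]) auto
  qed
qed

lemma exists_closed_complement:
  assumes L: "subspace L" and fin: "codim smul L < \<infinity>"
  obtains S where "closed_complement smul L S"
proof -
  obtain B where B: "finite B" "span (B \<union> L) = UNIV"
    using codim_finiteE[OF fin] .
  obtain C where "finite C" "L + span C = span (B \<union> L)" "L \<inter> span C = {0}"
    using exists_span_complement[OF L B(1)] by (elim exE conjE)
  then show thesis
    using that[of "span C"] B(2)
    by (simp add: closed_complement_def closed_subspace_def closed_span_finite)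
qed

end

theorem theorem3p3p1:
  fixes smul :: "'k::{real_normed_field, euclidean_space} \<Rightarrow> 'a::banach \<Rightarrow> 'a"
    and M N :: "'a set" and N1 :: "nat set" and Mn Nn :: "nat \<Rightarrow> 'a set"
    and lM lN :: real
  assumes "banach_over smul"
    and "BFU_space smul"
    and "upper_semi_Fredholm smul M N"
    and "M \<noteq> {0}" and "N \<noteq> {0}"
    and "infinite N1"
    and "\<forall>n\<in>N1. closed_subspace smul (Mn n) \<and> closed_subspace smul (Nn n)"
    and "lM = adj_lambda N1 (\<lambda>_. M) Mn"
    and "lN = adj_lambda N1 (\<lambda>_. N) Nn"
  shows
    "(psi smul M N * (lM + lN) < 1 \<longrightarrow>
        (\<forall>\<^sub>F n in along N1. upper_semi_Fredholm smul (Mn n) (Nn n)) \<and>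
        Limsup (along N1) (\<lambda>n. defect smul (Mn n) (Nn n)) < \<infinity>)
     \<and>
     (\<forall>S. closed_complement smul (M + N) S \<and> psi_compl S M N * (lM + lN) < 1 \<longrightarrow>
        (\<forall>N2 (W :: nat \<Rightarrow> ('a \<Rightarrow>\<^sub>L 'k) set).
           N2 \<subseteq> N1 \<and> infinite N2 \<and>
           (\<forall>n\<in>N2. closed_subspace dual_scale (W n) \<and> W n \<noteq> {0} \<and>
                    W n \<subseteq> annihilator smul (Mn n)) \<and>
           ((\<lambda>n. gap (W n) (annihilator smul (Nn n))) \<longlongrightarrow> 0) (along N2) \<longrightarrow>
           (\<exists>K::nat. \<forall>\<^sub>F n in along N2. edim dual_scale (W n) \<le> enat K)))"
proof -
  interpret banach_over smul
    by fact
  have MN: "closed_subspace smul M" "closed_subspace smul N" "codim smul (M + N) < \<infinity>"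
    using assms(3) by (auto simp: upper_semi_Fredholm_def defect_def)
  have sub: "subspace (M + N)"
    using MN by (intro subspace_set_plus) (auto simp: closed_subspace_def)
  have cl: "closed_subspace smul (Mn n)" "closed_subspace smul (Nn n)" if "n \<in> N1" for n
    using assms(7) that by auto
  have 0: "0 \<in> Mn n \<and> 0 \<in> Nn n" if "n \<in> N1" for n
    using cl[OF that] subspace_0 by (auto simp: closed_subspace_def)
  have bounded: "\<exists>m. \<forall>n\<in>A. card (F n) \<le> m"
    if S: "closed_complement smul (M + N) S" "psi_compl S M N * (lM + lN) < 1" and "A \<subseteq> N1"
      and F: "\<And>n. n \<in> A \<Longrightarrow>
        finite (F n) \<and> F n \<subseteq> annihilator smul (Mn n) \<and> dual_space.independent (F n)"
      and almost: "\<And>n w b. n \<in> A \<Longrightarrow> w \<in> dual_space.span (F n) \<Longrightarrow> b \<in> Nn n \<Longrightarrow>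
        norm (blinfun_apply w b) \<le> r n * norm w * norm b"
      and r: "(r \<longlongrightarrow> 0) (along A)" for S A F r
  proof -
    have cS: "closed_subspace smul S" "M + N + S = UNIV" "(M + N) \<inter> S = {0}"
      using S(1) by (auto simp: closed_complement_def)
    obtain B where B: "finite B" "span (B \<union> (M + N)) = UNIV"
      using codim_finiteE[OF MN(3)] .
    have "subspace S"
      using cS(1) by (simp add: closed_subspace_def)
    then obtain C where C: "finite C" "S \<subseteq> span C"
      using complement_subset_span[OF sub B _ cS(2,3)] by blast
    show ?thesis
      by (rule card_almost_annihilating_bounded[OF assms(2) MN(1,2) cS(1) assms(4,5) cS(2) C])
        (fact 0 S(2)[unfolded assms(8,9)] \<open>A \<subseteq> N1\<close> F almost r)+
  qed
  have part1: "(\<forall>\<^sub>F n in along N1. upper_semi_Fredholm smul (Mn n) (Nn n)) \<and>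
      Limsup (along N1) (\<lambda>n. defect smul (Mn n) (Nn n)) < \<infinity>"
    if small: "psi smul M N * (lM + lN) < 1"
  proof -
    \<comment> \<open>The infimum over complements is traded for a single one that still satisfies
      the strict inequality; if \<open>lM + lN = 0\<close>, any complement does.\<close>
    have "\<exists>S. closed_complement smul (M + N) S \<and> psi_compl S M N * (lM + lN) < 1"
    proof (cases "lM + lN = 0")
      case True
      then show ?thesis
        using exists_closed_complement[OF sub MN(3)] by (metis mult_zero_right zero_less_one)
    next
      case False
      then have pos: "lM + lN > 0"
        using adj_lambda_nonneg[of N1 Mn "\<lambda>_. M"] adj_lambda_nonneg[of N1 Nn "\<lambda>_. N"] 0
        unfolding assms(8,9) by fastforce
      have ne: "{psi_compl S M N |S. closed_complement smul (M + N) S} \<noteq> {}"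
        using exists_closed_complement[OF sub MN(3)] by blast
      have "Inf {psi_compl S M N |S. closed_complement smul (M + N) S} < 1 / (lM + lN)"
        using small pos by (simp add: psi_def pos_less_divide_eq)
      from cInf_lessD[OF ne this] obtain S
        where "closed_complement smul (M + N) S" "psi_compl S M N < 1 / (lM + lN)"
        by blast
      then show ?thesis
        using pos by (auto simp: pos_less_divide_eq)
    qed
    then obtain S where S: "closed_complement smul (M + N) S" "psi_compl S M N * (lM + lN) < 1"
      by blast
    define d where "d n = defect smul (Mn n) (Nn n)" for n
    \<comment> \<open>An infinite defect is replaced by the index \<open>n\<close>; once
      \<open>k\<close> is bounded by \<open>m\<close>, no defect with \<open>n > m\<close> can be
      infinite.\<close>
    define k where "k n = (if d n = \<infinity> then n else the_enat (d n))" for n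
    have k: "enat (k n) \<le> codim smul (Mn n + Nn n)" for n
      by (cases "d n") (auto simp: k_def d_def defect_def)
    \<comment> \<open>Any positive null sequence can serve as tolerance; \<open>Suc\<close> keeps it
      positive at \<open>n = 0\<close>.\<close>
    have "\<exists>F. finite F \<and> card F = k n \<and> F \<subseteq> annihilator smul (Mn n) \<and> dual_space.independent F \<and>
        (\<forall>w\<in>dual_space.span F. \<forall>b\<in>Nn n.
          norm (blinfun_apply w b) \<le> inverse (real (Suc n)) * norm w * norm b)"
      if "n \<in> N1" for n
      by (rule exists_almost_annihilating_space[OF cl[OF that] k, of "inverse (real (Suc n))"]) auto
    then obtain F where F: "\<And>n. n \<in> N1 \<Longrightarrow> finite (F n) \<and> F n \<subseteq> annihilator smul (Mn n) \<and>
        dual_space.independent (F n)" "\<And>n. n \<in> N1 \<Longrightarrow> card (F n) = k n"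
      "\<And>n w b. n \<in> N1 \<Longrightarrow> w \<in> dual_space.span (F n) \<Longrightarrow> b \<in> Nn n \<Longrightarrow>
        norm (blinfun_apply w b) \<le> inverse (real (Suc n)) * norm w * norm b"
      by metis
    have "((\<lambda>n. inverse (real (Suc n))) \<longlongrightarrow> 0) (along N1)"
      using tendsto_mono[OF inf_le1 LIMSEQ_inverse_real_of_nat] .
    from bounded[OF S order_refl _ _ this] have "\<exists>m. \<forall>n\<in>N1. card (F n) \<le> m"
      using F by blast
    then obtain m where m: "\<And>n. n \<in> N1 \<Longrightarrow> k n \<le> m"
      using F(2) by auto
    have ev: "\<forall>\<^sub>F n in along N1. n \<in> N1 \<and> d n \<le> enat m"
      unfolding eventually_inf_principal using eventually_gt_at_top[of m]
    proof eventually_elim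
      case (elim n)
      show ?case
      proof (intro impI conjI)
        assume n: "n \<in> N1"
        show "d n \<le> enat m"
          using m[OF n] elim by (cases "d n") (auto simp: k_def)
      qed
    qed
    then have "\<forall>\<^sub>F n in along N1. upper_semi_Fredholm smul (Mn n) (Nn n)"
    proof eventually_elim
      case (elim n)
      then have "d n < \<infinity>"
        using order_le_less_trans[of "d n" "enat m" \<infinity>] by simp
      then show ?case
        using cl elim by (simp add: upper_semi_Fredholm_def d_def)
    qed
    moreover have "Limsup (along N1) d \<le> enat m"
      using ev by (intro Limsup_bounded) (auto elim: eventually_mono)
    then have "Limsup (along N1) d < \<infinity>"
      using order_le_less_trans[of _ "enat m" \<infinity>] by simp
    ultimately show ?thesis
      unfolding d_def by blast
  qed
  have part2: "\<exists>K::nat. \<forall>\<^sub>F n in along N2. edim dual_scale (W n) \<le> enat K"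
    if S: "closed_complement smul (M + N) S" "psi_compl S M N * (lM + lN) < 1" and "N2 \<subseteq> N1"
      and W: "\<forall>n\<in>N2. closed_subspace dual_scale (W n) \<and> W n \<noteq> {0} \<and> W n \<subseteq> annihilator smul (Mn n)"
      and gap: "((\<lambda>n. gap (W n) (annihilator smul (Nn n))) \<longlongrightarrow> 0) (along N2)"
    for S N2 and W :: "nat \<Rightarrow> ('a \<Rightarrow>\<^sub>L 'k) set"
  proof -
    have "\<exists>F. finite F \<and> F \<subseteq> W n \<and> dual_space.independent F \<and>
        (edim dual_scale (W n) = enat (card F) \<or> edim dual_scale (W n) = \<infinity> \<and> card F = n)" for n
      by (rule dual_space.exists_independent_subset_edim)
    then obtain F where F: "\<And>n. finite (F n) \<and> F n \<subseteq> W n \<and> dual_space.independent (F n)"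
      and edim: "\<And>n. edim dual_scale (W n) = enat (card (F n)) \<or>
        edim dual_scale (W n) = \<infinity> \<and> card (F n) = n"
      by metis
    have "finite (F n) \<and> F n \<subseteq> annihilator smul (Mn n) \<and> dual_space.independent (F n)"
      if "n \<in> N2" for n
      using F[of n] W that by blast
    moreover have "norm (blinfun_apply w b) \<le> gap (W n) (annihilator smul (Nn n)) * norm w * norm b"
      if n: "n \<in> N2" and w: "w \<in> dual_space.span (F n)" and b: "b \<in> Nn n" for n w b
    proof (rule gap_annihilator)
      show Wn: "dual_space.subspace (W n)"
        using W n by (simp add: closed_subspace_def)
      show "W n \<subseteq> dual smul"
        using W n by (auto simp: annihilator_def)
      show "w \<in> W n"
        using dual_space.span_minimal[of "F n" "W n"] F[of n] Wn w by blast
    qed fact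
    ultimately obtain m where m: "\<And>n. n \<in> N2 \<Longrightarrow> card (F n) \<le> m"
      using bounded[OF S \<open>N2 \<subseteq> N1\<close> _ _ gap, of F] by metis
    \<comment> \<open>If \<open>W n\<close> had infinite dimension, then
      \<open>card (F n) = n\<close>, which exceeds the bound once \<open>n > m\<close>.\<close>
    have "\<forall>\<^sub>F n in along N2. edim dual_scale (W n) \<le> enat m"
      unfolding eventually_inf_principal using eventually_gt_at_top[of m]
    proof eventually_elim
      case (elim n)
      then show ?case
        using m[of n] edim[of n] by auto
    qed
    then show ?thesis
      by blast
  qed
  show ?thesis
    using part1 part2 by blast
qed

end
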